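(* For every nonnegative integer $n$, the number of signed partitions $\sigma=(\pi,\nu)$ of $n$ such that (i) $\ell(\pi)$ is even, and each positive part is even and $\geq \ell(\pi)$, and (ii) the negative parts are odd, less than $\ell(\pi)$, and each value appears at most twice among the negative parts, equals the number of (ordinary) partitions of $n$ into parts congruent to $\pm 2, \pm 3, \pm 4, \pm 8 \pmod{18}$.
   Context: A partition $\lambda$ of length $\ell=\ell(\lambda)$ is an $\ell$-tuple $(\lambda_1,\dots,\lambda_\ell)$ of positive integers (its parts) with $\lambda_i\geq\lambda_{i+1}$ for $1\le i\le \ell-1$; its weight is $|\lambda|=\sum_i\lambda_i$, and it is a partition of $n$ if $|\lambda|=n$. The empty partition (length $0$, weight $0$) is allowed. A signed partition $\sigma$ of an integer $n$ is a pair $(\pi,\nu)$ of partitions with $n=|\pi|-|\nu|$; the parts of $\pi$ are called the positive parts of $\sigma$ and the parts of $\nu$ (which are positive integers) are called the negative parts of $\sigma$. *)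

theory Defs
  imports "HOL-Number_Theory.Cong"
begin

definition is_partition :: "nat list \<Rightarrow> bool" where
  "is_partition xs \<longleftrightarrow> sorted_wrt (\<ge>) xs \<and> (\<forall>p\<in>set xs. 0 < p)"

definition partition_of :: "nat list \<Rightarrow> nat \<Rightarrow> bool" where
  "partition_of xs n \<longleftrightarrow> is_partition xs \<and> sum_list xs = n"

text \<open>A signed partition is a pair \<open>(\<pi>, \<nu>)\<close>; its weight can be negative, hence the integer.
  The parts of \<open>\<nu>\<close> are stored as positive numbers.\<close>

definition signed_partition_of :: "nat list \<times> nat list \<Rightarrow> int \<Rightarrow> bool" where
  "signed_partition_of \<sigma> n \<longleftrightarrow>
     is_partition (fst \<sigma>) \<and> is_partition (snd \<sigma>) \<and>
     n = int (sum_list (fst \<sigma>)) - int (sum_list (snd \<sigma>))"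

end

theory Submission
  imports Defs "HOL-Computational_Algebra.Formal_Power_Series" "HOL-Library.Multiset"
begin

text \<open>
  The signed partitions with \<open>2m\<close> positive parts have a generating function that
  factors. The positive parts contribute \<open>X\<^bsup>4m\<^sup>2\<^esup> / (X\<^sup>2; X\<^sup>2)\<^bsub>2m\<^esub>\<close>. The
  negative parts contribute \<open>\<Prod>j<m. 1 + X\<^bsup>-(2j+1)\<^esup> + X\<^bsup>-(4j+2)\<^esup>\<close>, which is \<open>X\<^bsup>-2m\<^sup>2\<^esup>\<close>
  times the same product with positive exponents. So signed partitions are counted by
  \<open>\<Sum>m. X\<^bsup>2m\<^sup>2\<^esup> (\<Prod>j<m. 1 + X\<^bsup>2j+1\<^esup> + X\<^bsup>4j+2\<^esup>) / (X\<^sup>2; X\<^sup>2)\<^bsub>2m\<^esub>\<close> (\<open>signed_series_gf\<close>).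

  As \<open>1 + y + y\<^sup>2 = (1 - \<omega> y) (1 - \<omega>\<^bsup>-1\<^esup> y)\<close> for a primitive cube root of unity \<open>\<omega>\<close>,
  the finite form of Jacobi's triple product expands each summand as \<open>\<Sum>r. e\<^sub>r X\<^bsup>2m\<^sup>2 +
  r\<^sup>2\<^esup> / ((X\<^sup>2; X\<^sup>2)\<^bsub>m-r\<^esub> (X\<^sup>2; X\<^sup>2)\<^bsub>m+r\<^esub>)\<close>, where \<open>e\<close> is the sequence \<open>1, 1, 0, -1,
  -1, 0\<close> of period six (\<open>finite_jacobi_triple_product\<close>). In other words, this is a
  Bailey pair. The sum over \<open>m\<close> is then evaluated by Durfee rectangles
  (\<open>finite_durfee_rectangle\<close>, \<open>finite_bailey\<close>) and gives \<open>(\<Sum>r. e\<^sub>r X\<^bsup>3r\<^sup>2\<^esup>) / (X\<^sup>2;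
  X\<^sup>2)\<^sub>\<infinity>\<close>. The triple product, now with \<open>X\<^sup>3\<close> for \<open>X\<close>, turns the theta series back
  into a product, and cancellation leaves exactly the factors \<open>1 / (1 - X\<^sup>s)\<close> with \<open>s\<close>
  congruent to \<open>\<plusminus>2, \<plusminus>3, \<plusminus>4, \<plusminus>8\<close> modulo \<open>18\<close> (\<open>signed_series_product\<close>).

  Both identities are proved in exact finite versions, with a bound \<open>L\<close> on \<open>m\<close>.
  Infinite sums and products are avoided by comparing coefficients up to degree \<open>N\<close>
  with \<open>L = 2 N\<close>.
\<close>

unbundle fps_syntax

section \<open>Reciprocal q-factorials\<close>

text \<open>
  The series \<open>1 / ((1 - x) (1 - x\<^sup>2) \<dots> (1 - x\<^sup>k))\<close>. Setting it to \<open>0\<close> for negative \<open>k\<close>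
  extends \<open>1 / (x; x)\<^bsub>k-1\<^esub> = (1 - x\<^sup>k) / (x; x)\<^sub>k\<close> to \<open>k = 0\<close>, so that sums over an
  integer \<open>r\<close> with factors indexed by \<open>m - r\<close> and \<open>m + r\<close> cut themselves off at \<open>\<bar>r\<bar> =
  m\<close>.
\<close>

definition qfac_recip :: "'a::field fps \<Rightarrow> int \<Rightarrow> 'a fps" where
  "qfac_recip x k = (if k < 0 then 0 else inverse (\<Prod>i=1..nat k. 1 - x ^ i))"

lemma nth_0_one_minus_power:
  fixes x :: "'a::field fps"
  assumes "x $ 0 = 0" "0 < i"
  shows "(1 - x ^ i) $ 0 = 1"
  using assms by (simp add: fps_power_zeroth)

lemma qfac_recip_neg: "k < 0 \<Longrightarrow> qfac_recip x k = 0"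
  by (simp add: qfac_recip_def)

lemma qfac_recip_0 [simp]: "qfac_recip x 0 = 1"
  by (simp add: qfac_recip_def)

lemma qfac_recip_Suc:
  fixes x :: "'a::field fps"
  assumes "x $ 0 = 0"
  shows "qfac_recip x (int n) = (1 - x ^ Suc n) * qfac_recip x (int (Suc n))"
proof -
  have "(1 - x ^ Suc n) $ 0 \<noteq> 0"
    by (subst nth_0_one_minus_power[OF assms]) simp_all
  then have "(1 - x ^ Suc n) * inverse (1 - x ^ Suc n) = 1"
    by (rule inverse_mult_eq_1')
  moreover have "nat (int (Suc n)) = Suc n" by (rule nat_int)
  ultimately show ?thesis
    unfolding qfac_recip_def
    by (simp add: fps_inverse_mult mult.assoc [symmetric] mult.commute del: power_Suc of_nat_Suc)
qed

lemma qfac_recip_rec: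
  fixes x :: "'a::field fps"
  assumes "x $ 0 = 0"
  shows "qfac_recip x (k - 1) = (1 - x ^ nat k) * qfac_recip x k"
proof (cases "k \<le> 0")
  case True
  then show ?thesis by (auto simp: qfac_recip_def)
next
  case False
  then obtain n where k: "k = int (Suc n)"
    by (metis not_le zero_less_imp_eq_int gr0_conv_Suc)
  then have "k - 1 = int n" "nat k = Suc n" by simp_all
  then show ?thesis using qfac_recip_Suc[OF assms, of n] by (simp only: k)
qed

lemma one_minus_power_neq_0:
  fixes x :: "'a::field fps"
  assumes "x $ 0 = 0" "0 < i"
  shows "1 - x ^ i \<noteq> 0"
  using nth_0_one_minus_power[OF assms] by (metis fps_zero_nth zero_neq_one)

section \<open>Finite forms of the triple product and of the Bailey lemma\<close>

text \<open>
  Two applications of the Pascal rule to the Gaussian binomial \<open>[2m + 2, m + 1 + r]\<close>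
  in base \<open>q\<^sup>2\<close>, divided by \<open>(q\<^sup>2; q\<^sup>2)\<^bsub>2m\<^esub>\<close>. The powers of \<open>q\<close> are
  arranged so that the Pascal weights complete the squares: \<open>(r - 1)\<^sup>2 + 2m + 1 = r\<^sup>2
  + 2 (m + 1 - r)\<close>, and likewise for \<open>r + 1\<close>.
\<close>

lemma jacobi_coeff_step:
  fixes q :: "'a::field fps" and r :: int and m :: nat
  assumes q0: "q $ 0 = 0" and r: "\<bar>r\<bar> \<le> int m + 1"
  defines "R \<equiv> qfac_recip (q ^ 2)"
  shows "(1 - q ^ (4*m+2)) * (1 - q ^ (4*m+4)) * (q ^ nat (r\<^sup>2) * (R (int m + 1 - r) * R (int m + 1 + r)))
    = (1 + q ^ (4*m+2)) * (q ^ nat (r\<^sup>2) * (R (int m - r) * R (int m + r)))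
      + q ^ (2*m+1) * (q ^ nat ((r-1)\<^sup>2) * (R (int m - (r-1)) * R (int m + (r-1)))
                     + q ^ nat ((r+1)\<^sup>2) * (R (int m - (r+1)) * R (int m + (r+1))))"
proof -
  define a where "a = q ^ (2 * nat (int m + 1 - r))"
  define b where "b = q ^ (2 * nat (int m + 1 + r))"
  define a' where "a' = q ^ (2 * nat (int m - r))"
  define b' where "b' = q ^ (2 * nat (int m + r))"
  define U where "U = R (int m + 1 - r)"
  define V where "V = R (int m + 1 + r)"
  have x0: "(q ^ 2) $ 0 = 0" using q0 by (simp add: fps_power_zeroth)
  have rec: "R (k - 1) = (1 - q ^ (2 * nat k)) * R k" for k
    unfolding R_def using qfac_recip_rec[OF x0, of k] by (simp add: power_mult)
  have Um: "R (int m - r) = (1 - a) * U"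
    using rec[of "int m + 1 - r"] by (simp add: a_def U_def)
  have Um1: "R (int m - (r + 1)) = (1 - a') * ((1 - a) * U)"
    using rec[of "int m - r"] Um by (simp add: a'_def algebra_simps)
  have Vm: "R (int m + r) = (1 - b) * V"
    using rec[of "int m + 1 + r"] by (simp add: b_def V_def algebra_simps)
  have Vm1: "R (int m + (r - 1)) = (1 - b') * ((1 - b) * V)"
    using rec[of "int m + r"] Vm by (simp add: b'_def add_diff_eq)
  have U0: "R (int m - (r - 1)) = U" "R (int m + (r + 1)) = V"
    by (simp_all add: U_def V_def algebra_simps)
  have sq: "int (nat (s\<^sup>2)) = s\<^sup>2" for s by simp
  have ea: "q ^ (2*m+1) * q ^ nat ((r-1)\<^sup>2) = q ^ nat (r\<^sup>2) * a"
  proof -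
    have "int (nat (int m + 1 - r)) = int m + 1 - r" using r by simp
    then have "int (2*m+1 + nat ((r-1)\<^sup>2)) = int (nat (r\<^sup>2) + 2 * nat (int m + 1 - r))"
      unfolding of_nat_add of_nat_mult sq by (simp add: power2_eq_square algebra_simps)
    then have "2*m+1 + nat ((r-1)\<^sup>2) = nat (r\<^sup>2) + 2 * nat (int m + 1 - r)"
      by (simp only: of_nat_eq_iff)
    then show ?thesis by (simp only: a_def power_add [symmetric])
  qed
  have eb: "q ^ (2*m+1) * q ^ nat ((r+1)\<^sup>2) = q ^ nat (r\<^sup>2) * b"
  proof -
    have "int (nat (int m + 1 + r)) = int m + 1 + r" using r by simp
    then have "int (2*m+1 + nat ((r+1)\<^sup>2)) = int (nat (r\<^sup>2) + 2 * nat (int m + 1 + r))"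
      unfolding of_nat_add of_nat_mult sq by (simp add: power2_eq_square algebra_simps)
    then have "2*m+1 + nat ((r+1)\<^sup>2) = nat (r\<^sup>2) + 2 * nat (int m + 1 + r)"
      by (simp only: of_nat_eq_iff)
    then show ?thesis by (simp only: b_def power_add [symmetric])
  qed
  define y where "y = q ^ (4*m+2)"
  define z where "z = q ^ (4*m+4)"
  \<comment> \<open>All that remains of the Pascal rules. At \<open>r = \<plusminus>(m + 1)\<close> one of the truncated exponents
    \<open>nat (m \<mp> r)\<close> is off by one, but the factor \<open>1 - a\<close> or \<open>1 - b\<close> next to it vanishes.\<close>
  have key: "(1 - y) * (1 - z) = (1 + y) * ((1 - a) * (1 - b)) + a * ((1 - b') * (1 - b))
      + b * ((1 - a') * (1 - a))"
  proof -
    have ab: "a * b = z"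
    proof -
      have "2 * nat (int m + 1 - r) + 2 * nat (int m + 1 + r) = 4*m+4" using r by linarith
      then show ?thesis by (simp only: a_def b_def z_def power_add [symmetric])
    qed
    consider "r = int m + 1" | "r = - int m - 1" | "\<bar>r\<bar> \<le> int m" using r by linarith
    then show ?thesis
    proof cases
      case 1
      then have "2 * nat (int m + 1 - r) = 0" "2 * nat (int m + r) = 4*m+2" by linarith+
      then have "a = 1" "b' = y" by (simp_all only: a_def b'_def y_def power_0)
      then show ?thesis using ab by (simp add: algebra_simps)
    next
      case 2
      then have "2 * nat (int m + 1 + r) = 0" "2 * nat (int m - r) = 4*m+2" by linarith+
      then have "b = 1" "a' = y" by (simp_all only: b_def a'_def y_def power_0)
      then show ?thesis using ab by (simp add: algebra_simps)
    next
      case 3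
      have "2 * nat (int m + 1 - r) + 2 * nat (int m + r) = 4*m+2"
           "2 * nat (int m - r) + 2 * nat (int m + 1 + r) = 4*m+2" using 3 by linarith+
      then have "a * b' = y" "a' * b = y"
        by (simp_all only: a_def b_def a'_def b'_def y_def power_add [symmetric])
      moreover have "(1 - a) * (1 - b) = 1 - a - b + a * b"
        "a * ((1 - b') * (1 - b)) = a - a * b - a * b' + (a * b') * b"
        "b * ((1 - a') * (1 - a)) = b - a * b - a' * b + (a' * b) * a"
        by (simp_all add: algebra_simps)
      ultimately show ?thesis by (simp add: ab algebra_simps)
    qed
  qed
  have "q ^ (2*m+1) * (q ^ nat ((r-1)\<^sup>2) * (R (int m - (r-1)) * R (int m + (r-1)))
                     + q ^ nat ((r+1)\<^sup>2) * (R (int m - (r+1)) * R (int m + (r+1))))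
     = (q ^ (2*m+1) * q ^ nat ((r-1)\<^sup>2)) * (U * ((1 - b') * ((1 - b) * V)))
     + (q ^ (2*m+1) * q ^ nat ((r+1)\<^sup>2)) * ((1 - a') * ((1 - a) * U) * V)"
    unfolding U0 Um1 Vm1 by (simp only: distrib_left mult.assoc)
  also have "\<dots> = q ^ nat (r\<^sup>2) * (a * ((1 - b') * (1 - b)) + b * ((1 - a') * (1 - a))) * (U * V)"
    unfolding ea eb by algebra
  finally show ?thesis
    unfolding Um Vm U_def [symmetric] V_def [symmetric] y_def [symmetric] z_def [symmetric] key
    by (simp only:) (simp only: distrib_left distrib_right mult_ac add_ac)
qed

text \<open>
  In the usual finite triple product the coefficient of the \<open>r\<close>-th term is \<open>z\<^sup>r\<close>, and
  the product has factors \<open>(1 + z q\<^bsup>2j+1\<^esup>) (1 + z\<^bsup>-1\<^esup> q\<^bsup>2j+1\<^esup>)\<close>. The induction on \<open>m\<close>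
  uses only that \<open>z\<^bsup>r+1\<^esup> + z\<^bsup>r-1\<^esup>\<close> is a fixed multiple \<open>t\<close> of \<open>z\<^sup>r\<close>, so any sequence
  with this recurrence will do. This keeps the cube roots of unity out of the
  application, where \<open>t = 1\<close>.
\<close>

theorem finite_jacobi_triple_product:
  fixes q t :: "'a::field fps" and e :: "int \<Rightarrow> 'a fps"
  assumes q0: "q $ 0 = 0" and e: "\<And>r. e (r + 1) + e (r - 1) = t * e r"
  shows "(\<Sum>r=-int m..int m. e r * (q ^ nat (r\<^sup>2)
             * (qfac_recip (q\<^sup>2) (int m - r) * qfac_recip (q\<^sup>2) (int m + r))))
       = e 0 * qfac_recip (q\<^sup>2) (2 * int m) * (\<Prod>j<m. 1 + t * q ^ (2*j+1) + q ^ (4*j+2))"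
proof (induction m)
  case 0
  then show ?case by simp
next
  case (Suc m)
  define R where "R = qfac_recip (q\<^sup>2)"
  define c where "c = (\<lambda>m r. q ^ nat (r\<^sup>2) * (R (int m - r) * R (int m + r)))"
  define W where "W = (\<lambda>m. \<Prod>j<m. 1 + t * q ^ (2*j+1) + q ^ (4*j+2))"
  have x0: "(q ^ 2) $ 0 = 0" using q0 by (simp add: fps_power_zeroth)
  define I where "I = {-int m..int m}"
  define J where "J = {-int (Suc m)..int (Suc m)}"
  have c0: "c m r = 0" if "r \<notin> I" for r
    using that by (auto simp: I_def c_def R_def qfac_recip_neg)
  have ext: "(\<Sum>r\<in>K. f r * c m r) = (\<Sum>r\<in>I. f r * c m r)"
    if "I \<subseteq> K" "finite K" for f K
    using that by (intro sum.mono_neutral_right) (auto simp: c0)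
  have down: "(\<Sum>r\<in>J. e r * c m (r - 1)) = (\<Sum>r\<in>I. e (r + 1) * c m r)"
  proof -
    have "(\<Sum>r\<in>J. e r * c m (r - 1)) = (\<Sum>r\<in>{-int m-2..int m}. e (r + 1) * c m r)"
      by (rule sum.reindex_bij_witness[of _ "\<lambda>r. r + 1" "\<lambda>r. r - 1"]) (auto simp: J_def)
    also have "\<dots> = (\<Sum>r\<in>I. e (r + 1) * c m r)" by (rule ext) (auto simp: I_def)
    finally show ?thesis .
  qed
  have up: "(\<Sum>r\<in>J. e r * c m (r + 1)) = (\<Sum>r\<in>I. e (r - 1) * c m r)"
  proof -
    have "(\<Sum>r\<in>J. e r * c m (r + 1)) = (\<Sum>r\<in>{-int m..int m+2}. e (r - 1) * c m r)"
      by (rule sum.reindex_bij_witness[of _ "\<lambda>r. r - 1" "\<lambda>r. r + 1"]) (auto simp: J_def)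
    also have "\<dots> = (\<Sum>r\<in>I. e (r - 1) * c m r)" by (rule ext) (auto simp: I_def)
    finally show ?thesis .
  qed
  define D where "D = (1 - q ^ (4*m+2)) * (1 - q ^ (4*m+4))"
  have pw: "D * c (Suc m) r = (1 + q ^ (4*m+2)) * c m r + q ^ (2*m+1) * (c m (r - 1) + c m (r + 1))"
    if "r \<in> J" for r
  proof -
    have "\<bar>r\<bar> \<le> int m + 1" using that by (auto simp: J_def)
    from jacobi_coeff_step[OF q0 this]
    show ?thesis unfolding D_def c_def R_def by (simp add: algebra_simps)
  qed
  have "D * (\<Sum>r\<in>J. e r * c (Suc m) r) = (\<Sum>r\<in>J. e r * (D * c (Suc m) r))"
    by (simp add: sum_distrib_left mult.left_commute)
  also have "\<dots> = (\<Sum>r\<in>J. (1 + q ^ (4*m+2)) * (e r * c m r) + q ^ (2*m+1) * (e r * c m (r - 1))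
        + q ^ (2*m+1) * (e r * c m (r + 1)))"
    by (intro sum.cong refl) (simp only: pw, simp only: algebra_simps)
  also have "\<dots> = (1 + q ^ (4*m+2)) * (\<Sum>r\<in>J. e r * c m r)
      + q ^ (2*m+1) * (\<Sum>r\<in>J. e r * c m (r - 1)) + q ^ (2*m+1) * (\<Sum>r\<in>J. e r * c m (r + 1))"
    by (simp only: sum.distrib sum_distrib_left)
  also have "\<dots> = (1 + q ^ (4*m+2)) * (\<Sum>r\<in>I. e r * c m r)
      + q ^ (2*m+1) * (\<Sum>r\<in>I. (e (r + 1) + e (r - 1)) * c m r)"
    unfolding up down by (subst ext) (auto simp: I_def J_def distrib_right sum.distrib distrib_left)
  also have "\<dots> = (1 + t * q ^ (2*m+1) + q ^ (4*m+2)) * (\<Sum>r\<in>I. e r * c m r)"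
    unfolding e by (simp add: distrib_right sum_distrib_left [symmetric] mult.assoc mult.left_commute add_ac)
  also have "(\<Sum>r\<in>I. e r * c m r) = e 0 * R (2 * int m) * W m"
    using Suc by (simp only: I_def c_def R_def W_def)
  also have "R (2 * int m) = D * R (2 * int (Suc m))"
  proof -
    have "R (int (2*m)) = (1 - q ^ (2 * Suc (2*m))) * ((1 - q ^ (2 * Suc (Suc (2*m)))) * R (int (Suc (Suc (2*m)))))"
      using qfac_recip_Suc[OF x0, of "2*m"] qfac_recip_Suc[OF x0, of "Suc (2*m)"]
      unfolding R_def by (simp only: power_mult)
    moreover have "2 * Suc (2*m) = 4*m+2" "2 * Suc (Suc (2*m)) = 4*m+4"
      "int (2*m) = 2 * int m" "int (Suc (Suc (2*m))) = 2 * int (Suc m)" by simp_all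
    ultimately show ?thesis unfolding D_def mult.assoc by (simp only:)
  qed
  finally have "D * (\<Sum>r\<in>J. e r * c (Suc m) r) = D * (e 0 * R (2 * int (Suc m)) * W (Suc m))"
    by (simp add: W_def mult_ac)
  moreover have "D \<noteq> 0"
    unfolding D_def by (intro no_zero_divisors one_minus_power_neq_0 q0) simp_all
  ultimately show ?case by (simp add: J_def c_def R_def W_def)
qed

text \<open>
  This is a form of the q-Vandermonde identity; for \<open>N \<rightarrow> \<infinity>\<close> it counts partitions by
  their Durfee rectangle of shape \<open>k \<times> (k + d)\<close>. The induction on \<open>N\<close> splits \<open>1 -
  x\<^bsup>N+1\<^esup> = x\<^sup>k (1 - x\<^bsup>N+1-k\<^esup>) + (1 - x\<^sup>k)\<close> and thereby reduces to \<open>N\<close> with \<open>d + 1\<close>,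
  which is why \<open>d\<close> varies.
\<close>

lemma finite_durfee_rectangle:
  fixes x :: "'a::field fps"
  assumes x0: "x $ 0 = 0"
  defines "R \<equiv> \<lambda>n. qfac_recip x (int n)"
  shows "(\<Sum>k\<le>N. x ^ (k * (k + d)) * (R (N - k) * R k * R (k + d))) = R N * R (N + d)"
proof (induction N arbitrary: d)
  case 0
  then show ?case by (simp add: R_def)
next
  case (Suc N)
  have rec: "R n = (1 - x ^ Suc n) * R (Suc n)" for n
    unfolding R_def by (rule qfac_recip_Suc[OF x0])
  have "(1 - x ^ Suc N) * (\<Sum>k\<le>Suc N. x ^ (k * (k + d)) * (R (Suc N - k) * R k * R (k + d)))
    = (\<Sum>k\<le>Suc N. x ^ k * (1 - x ^ (Suc N - k)) * (x ^ (k * (k + d)) * (R (Suc N - k) * R k * R (k + d)))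
        + (1 - x ^ k) * (x ^ (k * (k + d)) * (R (Suc N - k) * R k * R (k + d))))"
  proof -
    have "1 - x ^ Suc N = x ^ k * (1 - x ^ (Suc N - k)) + (1 - x ^ k)" if "k \<le> Suc N" for k
    proof -
      have "x ^ Suc N = x ^ k * x ^ (Suc N - k)" using that by (simp only: power_add [symmetric] le_add_diff_inverse)
      then show ?thesis by (simp only: right_diff_distrib mult_1_right) simp
    qed
    then show ?thesis unfolding sum_distrib_left distrib_right [symmetric]
      by (intro sum.cong refl) (metis atMost_iff)
  qed
  also have "\<dots> = (\<Sum>k\<le>Suc N. x ^ k * (1 - x ^ (Suc N - k)) * (x ^ (k * (k + d)) * (R (Suc N - k) * R k * R (k + d))))
      + (\<Sum>k\<le>Suc N. (1 - x ^ k) * (x ^ (k * (k + d)) * (R (Suc N - k) * R k * R (k + d))))"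
    by (rule sum.distrib)
  also have "(\<Sum>k\<le>Suc N. x ^ k * (1 - x ^ (Suc N - k)) * (x ^ (k * (k + d)) * (R (Suc N - k) * R k * R (k + d))))
     = (\<Sum>k\<le>N. (1 - x ^ Suc (k + d)) * (x ^ (k * (k + Suc d)) * (R (N - k) * R k * R (k + Suc d))))"
  proof -
    have "x ^ k * (1 - x ^ (Suc N - k)) * (x ^ (k * (k + d)) * (R (Suc N - k) * R k * R (k + d)))
      = (1 - x ^ Suc (k + d)) * (x ^ (k * (k + Suc d)) * (R (N - k) * R k * R (k + Suc d)))"
      if "k \<le> N" for k
    proof -
      have 1: "R (N - k) = (1 - x ^ (Suc N - k)) * R (Suc N - k)"
        using rec[of "N - k"] that by (simp add: Suc_diff_le)
      have 2: "R (k + d) = (1 - x ^ Suc (k + d)) * R (k + Suc d)"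
        using rec[of "k + d"] by simp
      have 3: "x ^ (k * (k + Suc d)) = x ^ k * x ^ (k * (k + d))"
        by (simp add: power_add [symmetric])
      show ?thesis unfolding 1 2 3 by (simp only: mult_ac)
    qed
    moreover have "(\<Sum>k\<le>Suc N. x ^ k * (1 - x ^ (Suc N - k)) * (x ^ (k * (k + d)) * (R (Suc N - k) * R k * R (k + d))))
      = (\<Sum>k\<le>N. x ^ k * (1 - x ^ (Suc N - k)) * (x ^ (k * (k + d)) * (R (Suc N - k) * R k * R (k + d))))"
      by simp
    ultimately show ?thesis by (simp only:) (rule sum.cong[OF refl], simp only: atMost_iff)
  qed
  also have "(\<Sum>k\<le>Suc N. (1 - x ^ k) * (x ^ (k * (k + d)) * (R (Suc N - k) * R k * R (k + d))))
     = (\<Sum>k\<le>N. x ^ Suc (k + d) * (x ^ (k * (k + Suc d)) * (R (N - k) * R k * R (k + Suc d))))"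
  proof -
    have "(1 - x ^ Suc k) * (x ^ (Suc k * (Suc k + d)) * (R (N - k) * R (Suc k) * R (Suc k + d)))
      = x ^ Suc (k + d) * (x ^ (k * (k + Suc d)) * (R (N - k) * R k * R (k + Suc d)))" for k
    proof -
      have 3: "x ^ (Suc k * (Suc k + d)) = x ^ Suc (k + d) * x ^ (k * (k + Suc d))"
        unfolding power_add [symmetric] by (rule arg_cong) simp
      show ?thesis unfolding rec[of k] 3 by (simp only: mult_ac add_Suc add_Suc_right)
    qed
    moreover have "(\<Sum>k\<le>Suc N. (1 - x ^ k) * (x ^ (k * (k + d)) * (R (Suc N - k) * R k * R (k + d))))
      = (\<Sum>k\<le>N. (1 - x ^ Suc k) * (x ^ (Suc k * (Suc k + d)) * (R (N - k) * R (Suc k) * R (Suc k + d))))"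
      by (subst sum.atMost_Suc_shift) simp
    ultimately show ?thesis by (simp only:)
  qed
  also have "(\<Sum>k\<le>N. (1 - x ^ Suc (k + d)) * (x ^ (k * (k + Suc d)) * (R (N - k) * R k * R (k + Suc d))))
     + (\<Sum>k\<le>N. x ^ Suc (k + d) * (x ^ (k * (k + Suc d)) * (R (N - k) * R k * R (k + Suc d))))
     = (\<Sum>k\<le>N. x ^ (k * (k + Suc d)) * (R (N - k) * R k * R (k + Suc d)))"
    unfolding sum.distrib [symmetric] distrib_right [symmetric] by simp
  also have "\<dots> = R N * R (N + Suc d)" by (rule Suc.IH)
  also have "\<dots> = (1 - x ^ Suc N) * (R (Suc N) * R (Suc N + d))"
    unfolding rec[of N] by (simp add: mult.assoc)
  finally show ?case
    using one_minus_power_neq_0[OF x0, of "Suc N"] by (simp del: power_Suc sum.atMost_Suc)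
qed

text \<open>
  The Durfee rectangle identity with \<open>m = k + \<bar>r\<bar>\<close> and \<open>d = 2 \<bar>r\<bar>\<close>, as \<open>m\<^sup>2 = r\<^sup>2 + k (k + 2
  \<bar>r\<bar>)\<close>.
\<close>

lemma durfee_int:
  fixes x :: "'a::field fps"
  assumes x0: "x $ 0 = 0" and r: "\<bar>r\<bar> \<le> int L"
  defines "R \<equiv> qfac_recip x"
  shows "(\<Sum>m\<le>L. x ^ m\<^sup>2 * (R (int L - int m) * (R (int m - r) * R (int m + r))))
       = x ^ nat (r\<^sup>2) * (R (int L - r) * R (int L + r))"
proof -
  define s where "s = nat \<bar>r\<bar>"
  have sym: "R (int n - r) * R (int n + r) = R (int n - int s) * R (int n + int s)" for n
    by (cases "r \<ge> 0") (simp_all add: s_def)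
  have "r\<^sup>2 = int (s\<^sup>2)" by (simp add: s_def)
  then have s: "s \<le> L" "nat (r\<^sup>2) = s\<^sup>2" using r by (simp_all only: nat_int) (simp add: s_def)
  have "(\<Sum>m\<le>L. x ^ m\<^sup>2 * (R (int L - int m) * (R (int m - int s) * R (int m + int s))))
    = (\<Sum>m\<in>{s..L}. x ^ m\<^sup>2 * (R (int L - int m) * (R (int m - int s) * R (int m + int s))))"
    by (rule sum.mono_neutral_right) (auto simp: R_def qfac_recip_neg)
  also have "\<dots> = (\<Sum>k\<le>L - s. x ^ s\<^sup>2 * (x ^ (k * (k + 2 * s)) *
       (R (int (L - s - k)) * R (int k) * R (int (k + 2 * s)))))"
  proof (rule sum.reindex_bij_witness[of _ "\<lambda>k. k + s" "\<lambda>m. m - s"])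
    fix m assume m: "m \<in> {s..L}"
    then obtain k where k: "m = s + k" by (metis atLeastAtMost_iff le_Suc_ex)
    have "m\<^sup>2 = s\<^sup>2 + k * (k + 2 * s)" by (simp add: k power2_eq_square algebra_simps)
    then have "x ^ m\<^sup>2 = x ^ s\<^sup>2 * x ^ (k * (k + 2 * s))" by (simp only: power_add)
    moreover have "int L - int m = int (L - s - k)" "m - s = k" "int m - int s = int k"
      "int m + int s = int (k + 2 * s)" using m k by auto
    ultimately show "x ^ s\<^sup>2 * (x ^ ((m - s) * (m - s + 2 * s)) *
       (R (int (L - s - (m - s))) * R (int (m - s)) * R (int (m - s + 2 * s))))
       = x ^ m\<^sup>2 * (R (int L - int m) * (R (int m - int s) * R (int m + int s)))"
      by (simp only: mult_ac)
  qed (use s in auto)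
  also have "\<dots> = x ^ s\<^sup>2 * (R (int (L - s)) * R (int (L - s + 2 * s)))"
    unfolding sum_distrib_left [symmetric] R_def by (subst finite_durfee_rectangle[OF x0]) simp
  also have "\<dots> = x ^ s\<^sup>2 * (R (int L - int s) * R (int L + int s))"
    using s by (simp add: of_nat_diff add.commute)
  finally show ?thesis by (simp only: sym s)
qed

text \<open>
  Expand every product by the finite triple product, exchange the sums, and evaluate
  the sum over \<open>m\<close> by the Durfee rectangle identity, which contributes a further
  factor \<open>q\<^bsup>2r\<^sup>2\<^esup>\<close>. So summation replaces \<open>q\<close> by \<open>q\<^sup>3\<close> in the theta series, while the
  base of the reciprocal q-factorials remains \<open>q\<^sup>2\<close>.
\<close>

theorem finite_bailey:
  fixes q t :: "'a::field fps" and e :: "int \<Rightarrow> 'a fps"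
  assumes q0: "q $ 0 = 0" and e: "\<And>r. e (r + 1) + e (r - 1) = t * e r"
  defines "R \<equiv> qfac_recip (q\<^sup>2)"
  shows "(\<Sum>m\<le>L. q ^ (2 * m\<^sup>2) * R (int L - int m)
            * (e 0 * R (2 * int m) * (\<Prod>j<m. 1 + t * q ^ (2*j+1) + q ^ (4*j+2))))
       = (\<Sum>r=-int L..int L. e r * ((q ^ 3) ^ nat (r\<^sup>2) * (R (int L - r) * R (int L + r))))"
proof -
  have x0: "(q ^ 2) $ 0 = 0" using q0 by (simp add: fps_power_zeroth)
  have "(\<Sum>m\<le>L. q ^ (2 * m\<^sup>2) * R (int L - int m)
            * (e 0 * R (2 * int m) * (\<Prod>j<m. 1 + t * q ^ (2*j+1) + q ^ (4*j+2))))
     = (\<Sum>m\<le>L. \<Sum>r=-int L..int L. q ^ (2 * m\<^sup>2) * R (int L - int m)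
            * (e r * (q ^ nat (r\<^sup>2) * (R (int m - r) * R (int m + r)))))"
  proof (rule sum.cong[OF refl])
    fix m assume m: "m \<in> {..L}"
    have "e 0 * R (2 * int m) * (\<Prod>j<m. 1 + t * q ^ (2*j+1) + q ^ (4*j+2))
      = (\<Sum>r=-int m..int m. e r * (q ^ nat (r\<^sup>2) * (R (int m - r) * R (int m + r))))"
      unfolding R_def by (rule finite_jacobi_triple_product[OF q0 e, symmetric])
    also have "\<dots> = (\<Sum>r=-int L..int L. e r * (q ^ nat (r\<^sup>2) * (R (int m - r) * R (int m + r))))"
      using m by (intro sum.mono_neutral_left) (auto simp: R_def qfac_recip_neg)
    finally show "q ^ (2 * m\<^sup>2) * R (int L - int m)
            * (e 0 * R (2 * int m) * (\<Prod>j<m. 1 + t * q ^ (2*j+1) + q ^ (4*j+2)))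
       = (\<Sum>r=-int L..int L. q ^ (2 * m\<^sup>2) * R (int L - int m)
            * (e r * (q ^ nat (r\<^sup>2) * (R (int m - r) * R (int m + r)))))"
      by (simp only: sum_distrib_left)
  qed
  also have "\<dots> = (\<Sum>r=-int L..int L. \<Sum>m\<le>L. q ^ (2 * m\<^sup>2) * R (int L - int m)
            * (e r * (q ^ nat (r\<^sup>2) * (R (int m - r) * R (int m + r)))))"
    by (rule sum.swap)
  also have "\<dots> = (\<Sum>r=-int L..int L. e r * q ^ nat (r\<^sup>2) * (\<Sum>m\<le>L. (q\<^sup>2) ^ m\<^sup>2 *
            (R (int L - int m) * (R (int m - r) * R (int m + r)))))"
    by (simp only: sum_distrib_left power_mult [symmetric] mult_ac)
  also have "\<dots> = (\<Sum>r=-int L..int L. e r * q ^ nat (r\<^sup>2) *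
            ((q\<^sup>2) ^ nat (r\<^sup>2) * (R (int L - r) * R (int L + r))))"
    unfolding R_def by (rule sum.cong[OF refl], subst durfee_int[OF x0]) auto
  also have "\<dots> = (\<Sum>r=-int L..int L. e r * ((q ^ 3) ^ nat (r\<^sup>2) * (R (int L - r) * R (int L + r))))"
    by (rule sum.cong[OF refl]) (simp add: power3_eq_cube power2_eq_square power_mult_distrib mult_ac)
  finally show ?thesis .
qed

section \<open>Power series up to a given degree\<close>

definition fps_eq_upto :: "nat \<Rightarrow> 'a::comm_ring_1 fps \<Rightarrow> 'a fps \<Rightarrow> bool" where
  "fps_eq_upto N f g \<longleftrightarrow> (\<forall>k\<le>N. f $ k = g $ k)"

lemma fps_eq_upto_refl [simp]: "fps_eq_upto N f f"
  by (simp add: fps_eq_upto_def)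

lemma fps_eq_upto_sym: "fps_eq_upto N f g \<Longrightarrow> fps_eq_upto N g f"
  by (simp add: fps_eq_upto_def)

lemma fps_eq_upto_trans [trans]: "fps_eq_upto N f g \<Longrightarrow> fps_eq_upto N g h \<Longrightarrow> fps_eq_upto N f h"
  by (simp add: fps_eq_upto_def)

lemma fps_eq_upto_add: "fps_eq_upto N f g \<Longrightarrow> fps_eq_upto N f' g' \<Longrightarrow> fps_eq_upto N (f + f') (g + g')"
  by (simp add: fps_eq_upto_def)

lemma fps_eq_upto_diff: "fps_eq_upto N f g \<Longrightarrow> fps_eq_upto N f' g' \<Longrightarrow> fps_eq_upto N (f - f') (g - g')"
  by (simp add: fps_eq_upto_def)

lemma fps_eq_upto_mult: "fps_eq_upto N f g \<Longrightarrow> fps_eq_upto N f' g' \<Longrightarrow> fps_eq_upto N (f * f') (g * g')"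
  unfolding fps_eq_upto_def by (auto simp: fps_mult_nth intro!: sum.cong)

lemma fps_eq_upto_sum: "(\<And>a. a \<in> A \<Longrightarrow> fps_eq_upto N (f a) (g a)) \<Longrightarrow> fps_eq_upto N (sum f A) (sum g A)"
  by (induction A rule: infinite_finite_induct) (simp_all add: fps_eq_upto_add)

lemma fps_eq_upto_prod: "(\<And>a. a \<in> A \<Longrightarrow> fps_eq_upto N (f a) (g a)) \<Longrightarrow> fps_eq_upto N (prod f A) (prod g A)"
  by (induction A rule: infinite_finite_induct) (simp_all add: fps_eq_upto_mult)

lemma fps_eq_upto_X_power_mult: "N < k \<Longrightarrow> fps_eq_upto N (fps_X ^ k * f) 0"
  by (simp add: fps_eq_upto_def fps_X_power_mult_nth)

lemma fps_eq_upto_X_power: "N < k \<Longrightarrow> fps_eq_upto N (fps_X ^ k) 0"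
  using fps_eq_upto_X_power_mult[of N k 1] by simp

lemma fps_eq_upto_cancel:
  fixes f g u :: "'a::field fps"
  assumes "fps_eq_upto N (u * f) (u * g)" "u $ 0 \<noteq> 0"
  shows "fps_eq_upto N f g"
proof -
  have "fps_eq_upto N (inverse u * (u * f)) (inverse u * (u * g))"
    by (rule fps_eq_upto_mult[OF fps_eq_upto_refl assms(1)])
  then show ?thesis by (simp only: mult.assoc [symmetric] inverse_mult_eq_1[OF assms(2)] mult_1_left)
qed

definition euler_prod :: "nat set \<Rightarrow> 'a::field fps" where
  "euler_prod A = (\<Prod>s\<in>A. 1 - fps_X ^ s)"

lemma euler_prod_nth_0: 
  assumes "finite A" "0 \<notin> A"
  shows "(euler_prod A :: 'a::field fps) $ 0 = 1"
  using assms unfolding euler_prod_def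
  by (induction A rule: finite_induct) (auto simp: fps_power_zeroth)

text \<open>
  A factor \<open>1 - X\<^sup>s\<close> with \<open>s > N\<close> is \<open>1\<close> up to degree \<open>N\<close>.
\<close>

lemma euler_prod_truncate:
  assumes "finite A" "finite B" "A \<inter> {..N} = B \<inter> {..N}"
  shows "fps_eq_upto N (euler_prod A) (euler_prod B)"
proof -
  have *: "fps_eq_upto N (euler_prod C :: 'a fps) (euler_prod (C \<inter> {..N}))" if "finite C" for C
  proof -
    have "(euler_prod C :: 'a fps) = euler_prod (C \<inter> {..N}) * euler_prod (C - {..N})"
      unfolding euler_prod_def by (rule prod.Int_Diff) (rule that)
    moreover have "fps_eq_upto N (euler_prod (C - {..N}) :: 'a fps) (\<Prod>s\<in>C - {..N}. 1)"
      unfolding euler_prod_def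
    proof (rule fps_eq_upto_prod)
      fix s assume "s \<in> C - {..N}"
      then have "fps_eq_upto N (1 - fps_X ^ s :: 'a fps) (1 - 0)"
        by (intro fps_eq_upto_diff fps_eq_upto_X_power) auto
      then show "fps_eq_upto N (1 - fps_X ^ s :: 'a fps) 1" by simp
    qed
    ultimately show ?thesis
      using fps_eq_upto_mult[of N "euler_prod (C \<inter> {..N}) :: 'a fps" "euler_prod (C \<inter> {..N})"
          "euler_prod (C - {..N})" 1] by simp
  qed
  from *[OF assms(1)] *[OF assms(2)] show ?thesis
    unfolding assms(3) by (meson fps_eq_upto_sym fps_eq_upto_trans)
qed

lemma qfac_recip_euler_prod:
  assumes "0 < c"
  shows "qfac_recip (fps_X ^ c :: 'a::field fps) (int k) * euler_prod ((\<lambda>i. c * i) ` {1..k}) = 1"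
proof -
  have inj: "inj_on ((*) c) {1..k}" using assms by (auto intro: inj_onI)
  have "(euler_prod ((\<lambda>i. c * i) ` {1..k}) :: 'a fps) = (\<Prod>i=1..k. 1 - (fps_X ^ c) ^ i)"
    unfolding euler_prod_def by (subst prod.reindex[OF inj]) (simp add: power_mult)
  moreover have "(euler_prod ((\<lambda>i. c * i) ` {1..k}) :: 'a fps) $ 0 = 1"
    using assms by (intro euler_prod_nth_0) auto
  ultimately show ?thesis by (simp add: qfac_recip_def inverse_mult_eq_1)
qed

lemma qfac_recip_truncate:
  assumes "0 < c" "N \<le> k" "N \<le> l"
  shows "fps_eq_upto N (qfac_recip (fps_X ^ c :: 'a::field fps) (int k)) (qfac_recip (fps_X ^ c) (int l))"
proof -
  let ?E = "\<lambda>k. euler_prod ((\<lambda>i. c * i) ` {1..k}) :: 'a fps"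
  let ?R = "\<lambda>k. qfac_recip (fps_X ^ c :: 'a::field fps) (int k)"
  have bd: "i \<le> n" if "c * i \<le> N" "N \<le> n" for i n
    using that assms(1) by (metis le_trans mult_le_mono1 nat_mult_1 Suc_leI One_nat_def)
  have "fps_eq_upto N (?E k) (?E l)"
    using assms by (intro euler_prod_truncate) (auto intro!: bd)
  then have "fps_eq_upto N (?R k * ?R l * ?E l) (?R k * ?R l * ?E k)"
    by (intro fps_eq_upto_mult) (auto simp: fps_eq_upto_sym)
  moreover have "?R k * ?R l * ?E l = ?R k"
    by (simp only: mult.assoc qfac_recip_euler_prod[OF assms(1)] mult_1_right)
  moreover have "?R k * ?R l * ?E k = (?R k * ?E k) * ?R l" by (simp only: mult_ac)
  ultimately show ?thesis by (simp only: qfac_recip_euler_prod[OF assms(1)] mult_1_left)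
qed

section \<open>The product formula for the signed series\<close>

text \<open>
  The sequence \<open>1, 1, 0, -1, -1, 0\<close>, repeated. It satisfies \<open>e (r + 1) - e r + e (r -
  1) = 0\<close>, whose characteristic roots are \<open>-\<omega>\<close> and \<open>-\<omega>\<^bsup>-1\<^esup>\<close> for a primitive cube root
  of unity \<open>\<omega>\<close>, and so it belongs to the factors \<open>1 + y + y\<^sup>2 = (1 - \<omega> y) (1 - \<omega>\<^bsup>-1\<^esup>
  y)\<close>.
\<close>

definition period6 :: "int \<Rightarrow> 'a::comm_ring_1" where
  "period6 r = (if r mod 6 \<in> {0, 1} then 1 else if r mod 6 \<in> {3, 4} then -1 else 0)"

lemma period6_0 [simp]: "period6 0 = 1"
  by (simp add: period6_def)

lemma period6_rec: "period6 (r + 1) + period6 (r - 1) = (1 :: 'a::comm_ring_1) * period6 r"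
proof -
  have shift: "(r + 1) mod 6 = (r mod 6 + 1) mod 6" "(r - 1) mod 6 = (r mod 6 - 1) mod 6"
    by (simp_all only: mod_simps)
  have "r mod 6 = 0 \<or> r mod 6 = 1 \<or> r mod 6 = 2 \<or> r mod 6 = 3 \<or> r mod 6 = 4 \<or> r mod 6 = 5"
    by presburger
  then show ?thesis
    unfolding period6_def shift by (elim disjE) simp_all
qed

text \<open>
  The passage to the limit \<open>L \<rightarrow> \<infinity>\<close> in the finite identities. Terms with \<open>\<bar>r\<bar> > N\<close> have
  degree above \<open>N\<close>; for the others \<open>2 N \<plusminus> r \<ge> N\<close>, where the reciprocal q-factorials
  are already stationary up to degree \<open>N\<close>.
\<close>

lemma theta_truncate:
  fixes e :: "int \<Rightarrow> 'a::field fps"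
  assumes "0 < c"
  defines "R \<equiv> qfac_recip (fps_X ^ c)"
  shows "fps_eq_upto N
    (\<Sum>r=-int (2*N)..int (2*N). e r * ((fps_X ^ 3) ^ nat (r\<^sup>2) * (R (int (2*N) - r) * R (int (2*N) + r))))
    ((\<Sum>r=-int (2*N)..int (2*N). e r * (fps_X ^ 3) ^ nat (r\<^sup>2)) * (R (int N) * R (int N)))"
  unfolding sum_distrib_right
proof (rule fps_eq_upto_sum)
  fix r assume r: "r \<in> {-int (2*N)..int (2*N)}"
  show "fps_eq_upto N (e r * ((fps_X ^ 3) ^ nat (r\<^sup>2) * (R (int (2*N) - r) * R (int (2*N) + r))))
         (e r * (fps_X ^ 3) ^ nat (r\<^sup>2) * (R (int N) * R (int N)))"
  proof (cases "\<bar>r\<bar> \<le> int N")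
    case True
    have *: "fps_eq_upto N (R (int (2*N) - s)) (R (int N))" if "\<bar>s\<bar> \<le> int N" for s
    proof -
      have "int (2*N) - s = int (nat (int (2*N) - s))" "N \<le> nat (int (2*N) - s)"
        using that by auto
      then show ?thesis unfolding R_def using qfac_recip_truncate[OF assms(1)] by (metis order_refl)
    qed
    show ?thesis unfolding mult.assoc
      using *[of r] *[of "-r"] True by (intro fps_eq_upto_mult fps_eq_upto_refl) simp_all
  next
    case False
    have "\<bar>r\<bar> * 1 \<le> \<bar>r\<bar> * \<bar>r\<bar>" using False by (intro mult_left_mono) auto
    then have "int N < 3 * r\<^sup>2" using False by (simp add: power2_eq_square)
    then have "N < 3 * nat (r\<^sup>2)" by linarith
    then have *: "fps_eq_upto N (fps_X ^ (3 * nat (r\<^sup>2)) * f) (fps_X ^ (3 * nat (r\<^sup>2)) * g)" for f g :: "'a fps"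
      using fps_eq_upto_X_power_mult by (metis fps_eq_upto_sym fps_eq_upto_trans)
    show ?thesis
      using *[of "e r * (R (int (2*N) - r) * R (int (2*N) + r))" "e r * (R (int N) * R (int N))"]
      by (simp only: power_mult mult_ac)
  qed
qed

lemma qfac_recip_nth_0:
  assumes "0 < c" shows "qfac_recip (fps_X ^ c :: 'a::field fps) (int k) $ 0 \<noteq> 0"
proof
  assume "qfac_recip (fps_X ^ c :: 'a fps) (int k) $ 0 = 0"
  then show False using arg_cong[OF qfac_recip_euler_prod[OF assms, of k, where 'a='a], of "\<lambda>f. f $ 0"] by simp
qed

definition signed_series :: "nat \<Rightarrow> 'a::field fps" where
  "signed_series N = (\<Sum>m\<le>N. fps_X ^ (2 * m\<^sup>2) * qfac_recip (fps_X\<^sup>2) (int (2 * m))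
      * (\<Prod>j<m. 1 + fps_X ^ (2*j+1) + fps_X ^ (4*j+2)))"

text \<open>
  The limiting case of \<open>finite_bailey\<close>: the factor \<open>1 / (q\<^sup>2; q\<^sup>2)\<^bsub>L-m\<^esub>\<close> on its left
  hand side becomes independent of \<open>m\<close> and cancels against one of the two factors on
  the right.
\<close>

lemma signed_series_theta:
  fixes N :: nat
  defines "\<Theta> \<equiv> (\<Sum>r=-int (2*N)..int (2*N). period6 r * (fps_X ^ 3) ^ nat (r\<^sup>2)) :: 'a::field fps"
  shows "fps_eq_upto N (signed_series N) (\<Theta> * qfac_recip (fps_X\<^sup>2) (int N))"
proof -
  define R :: "int \<Rightarrow> 'a fps" where "R = qfac_recip (fps_X\<^sup>2)"
  define T :: "nat \<Rightarrow> 'a fps" where "T = (\<lambda>m. fps_X ^ (2 * m\<^sup>2) * R (int (2 * m))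
      * (\<Prod>j<m. 1 + fps_X ^ (2*j+1) + fps_X ^ (4*j+2)))"
  have "fps_eq_upto N (\<Sum>m\<le>2*N. R (int (2*N) - int m) * T m) (\<Sum>m\<le>2*N. if m \<le> N then R (int N) * T m else 0)"
  proof (rule fps_eq_upto_sum)
    fix m assume "m \<in> {..2*N}"
    show "fps_eq_upto N (R (int (2*N) - int m) * T m) (if m \<le> N then R (int N) * T m else 0)"
    proof (cases "m \<le> N")
      case True
      then have "int (2*N) - int m = int (2*N - m)" by simp
      then show ?thesis using True unfolding R_def
        by (auto simp only: if_True intro!: fps_eq_upto_mult fps_eq_upto_refl qfac_recip_truncate)
    next
      case False
      then have "N < m * 1" "m * 1 \<le> m * m" by auto
      then have "N < 2 * m\<^sup>2" by (simp only: power2_eq_square)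
      from fps_eq_upto_X_power_mult[OF this, of "R (int (2*N) - int m) * (R (int (2 * m)) * (\<Prod>j<m. 1 + fps_X ^ (2*j+1) + fps_X ^ (4*j+2)))"]
      show ?thesis using False by (simp only: T_def mult_ac if_False)
    qed
  qed
  also have "(\<Sum>m\<le>2*N. if m \<le> N then R (int N) * T m else 0) = (\<Sum>m\<le>N. R (int N) * T m)"
    by (rule sum.mono_neutral_cong_right) auto
  also have "\<dots> = R (int N) * signed_series N"
    by (simp only: signed_series_def T_def R_def sum_distrib_left)
  finally have 1: "fps_eq_upto N (\<Sum>m\<le>2*N. R (int (2*N) - int m) * T m) (R (int N) * signed_series N)" .
  have fps_X_nth_zero: "(fps_X :: 'a fps) $ 0 = 0" by simp
  have T: "R (int (2*N) - int m) * T m = fps_X ^ (2 * m\<^sup>2) * R (int (2*N) - int m)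
      * (period6 0 * R (2 * int m) * (\<Prod>j<m. 1 + 1 * fps_X ^ (2*j+1) + fps_X ^ (4*j+2)))" for m
    by (simp only: T_def period6_0 mult_1_left of_nat_mult of_nat_numeral mult_ac)
  have 2: "(\<Sum>m\<le>2*N. R (int (2*N) - int m) * T m)
     = (\<Sum>r=-int (2*N)..int (2*N). period6 r * ((fps_X ^ 3) ^ nat (r\<^sup>2) * (R (int (2*N) - r) * R (int (2*N) + r))))"
    unfolding T unfolding R_def
    by (rule finite_bailey[of "fps_X :: 'a fps" period6 1 "2*N", OF fps_X_nth_zero period6_rec])
  have "fps_eq_upto N (R (int N) * signed_series N) (\<Sum>m\<le>2*N. R (int (2*N) - int m) * T m)"
    by (rule fps_eq_upto_sym[OF 1])
  also have "fps_eq_upto N \<dots> (\<Theta> * (R (int N) * R (int N)))"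
    unfolding 2 unfolding \<Theta>_def R_def by (rule theta_truncate) simp
  finally have "fps_eq_upto N (R (int N) * signed_series N) (R (int N) * (\<Theta> * R (int N)))"
    by (simp only: mult_ac)
  then show ?thesis
    unfolding R_def by (rule fps_eq_upto_cancel) (rule qfac_recip_nth_0, simp)
qed

text \<open>
  The limiting case of the finite triple product with \<open>X\<^sup>3\<close> for \<open>q\<close>: the same theta
  series, seen as a product.
\<close>

lemma product_theta:
  fixes N :: nat
  defines "\<Theta> \<equiv> (\<Sum>r=-int (2*N)..int (2*N). period6 r * (fps_X ^ 3) ^ nat (r\<^sup>2)) :: 'a::field fps"
  shows "fps_eq_upto N (\<Prod>j<2*N. 1 + fps_X ^ (6*j+3) + fps_X ^ (12*j+6)) (\<Theta> * qfac_recip (fps_X ^ 6) (int N))"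
proof -
  define R :: "int \<Rightarrow> 'a fps" where "R = qfac_recip (fps_X ^ 6)"
  define W :: "'a fps" where "W = (\<Prod>j<2*N. 1 + fps_X ^ (6*j+3) + fps_X ^ (12*j+6))"
  have "(fps_X ^ 3 :: 'a fps) $ 0 = 0" by (simp add: fps_power_zeroth)
  from finite_jacobi_triple_product[of "fps_X ^ 3" period6 1 "2*N", OF this period6_rec]
  have "(\<Sum>r=-int (2*N)..int (2*N). period6 r * ((fps_X ^ 3) ^ nat (r\<^sup>2) * (R (int (2*N) - r) * R (int (2*N) + r))))
      = R (int (2 * (2*N))) * (\<Prod>j<2*N. 1 + (fps_X ^ 3) ^ (2*j+1) + (fps_X ^ 3) ^ (4*j+2))"
    by (simp add: R_def power_mult [symmetric] del: of_nat_mult) simp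
  also have "(\<Prod>j<2*N. 1 + (fps_X ^ 3) ^ (2*j+1) + (fps_X ^ 3) ^ (4*j+2)) = W"
    unfolding W_def power_mult [symmetric] by (simp add: distrib_left add_ac)
  finally have "fps_eq_upto N (R (int (2 * (2*N))) * W) (\<Theta> * (R (int N) * R (int N)))"
    using theta_truncate[of 6 N "period6 :: int \<Rightarrow> 'a fps"] unfolding R_def \<Theta>_def by (simp only:)
  moreover have "fps_eq_upto N (R (int N) * W) (R (int (2 * (2*N))) * W)"
    unfolding R_def by (intro fps_eq_upto_mult fps_eq_upto_refl qfac_recip_truncate) auto
  ultimately have "fps_eq_upto N (R (int N) * W) (R (int N) * (\<Theta> * R (int N)))"
    unfolding mult.left_commute[of "R (int N)" \<Theta>] by (metis fps_eq_upto_trans)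
  then show ?thesis
    unfolding R_def W_def by (rule fps_eq_upto_cancel) (rule qfac_recip_nth_0, simp)
qed

lemma multiples_upto:
  assumes "0 < (c :: nat)"
  shows "(\<lambda>i. c * i) ` {1..N} \<inter> {..N} = {s\<in>{1..N}. s mod c = 0} \<inter> {..N}"
proof (intro set_eqI iffI)
  fix s assume s: "s \<in> {s\<in>{1..N}. s mod c = 0} \<inter> {..N}"
  then obtain i where i: "s = c * i" by (auto simp: mod_eq_0_iff_dvd elim: dvdE)
  then have "c * i \<le> N" "1 \<le> i" using s by (auto simp: Suc_le_eq)
  moreover have "i \<le> c * i" using assms by simp
  ultimately have "1 \<le> i \<and> i \<le> N" by linarith
  then show "s \<in> (\<lambda>i. c * i) ` {1..N} \<inter> {..N}" using s i by (auto intro!: imageI)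
qed (use assms in auto)

lemma progression_upto:
  assumes "0 < b" "b < (c :: nat)" "N \<le> L"
  shows "(\<lambda>j. c * j + b) ` {..<L} \<inter> {..N} = {s\<in>{1..N}. s mod c = b} \<inter> {..N}"
proof (intro set_eqI iffI)
  fix s assume s: "s \<in> {s\<in>{1..N}. s mod c = b} \<inter> {..N}"
  then have "s = c * (s div c) + b" by (metis (mono_tags, lifting) IntD1 mem_Collect_eq mult_div_mod_eq)
  moreover have "s div c < s" using s assms by (intro div_less_dividend) auto
  then have "s div c \<in> {..<L}" using s assms(3) by auto
  ultimately show "s \<in> (\<lambda>j. c * j + b) ` {..<L} \<inter> {..N}" using s by blast
qed (use assms in auto)

text \<open>
  Eliminating the theta series leaves \<open>(\<Prod>j. 1 + X\<^bsup>6j+3\<^esup> + X\<^bsup>12j+6\<^esup>) (X\<^sup>6; X\<^sup>6) / (X\<^sup>2;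
  X\<^sup>2)\<close>, and since \<open>1 + y + y\<^sup>2 = (1 - y\<^sup>3) / (1 - y)\<close> this is \<open>(X\<^sup>9; X\<^bsup>18\<^esup>) (X\<^sup>6;
  X\<^sup>6) / ((X\<^sup>3; X\<^sup>6) (X\<^sup>2; X\<^sup>2))\<close>. The exponents that survive in the denominator are
  the even ones that \<open>6\<close> does not divide and those congruent to \<open>\<plusminus>3\<close> modulo \<open>18\<close>.
\<close>

theorem signed_series_product:
  "fps_eq_upto N (signed_series N * euler_prod {s\<in>{1..N}. s mod 18 \<in> {2,3,4,8,10,14,15,16}}) (1 :: 'a::field fps)"
proof -
  define R2 where "R2 = qfac_recip (fps_X\<^sup>2 :: 'a fps) (int N)"
  define R6 where "R6 = qfac_recip (fps_X ^ 6 :: 'a fps) (int N)"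
  define W :: "'a fps" where "W = (\<Prod>j<2*N. 1 + fps_X ^ (6*j+3) + fps_X ^ (12*j+6))"
  define E2 where "E2 = (euler_prod ((\<lambda>i. 2 * i) ` {1..N}) :: 'a fps)"
  define E6 where "E6 = (euler_prod ((\<lambda>i. 6 * i) ` {1..N}) :: 'a fps)"
  define E3 where "E3 = (euler_prod ((\<lambda>j. 6*j+3) ` {..<2*N}) :: 'a fps)"
  define E9 where "E9 = (euler_prod ((\<lambda>j. 18*j+9) ` {..<2*N}) :: 'a fps)"
  define P where "P = (\<lambda>C. euler_prod {s\<in>{1..N}. s mod 18 \<in> C} :: 'a fps)"
  define G where "G = (signed_series N :: 'a fps)"
  have R2: "R2 * E2 = 1" and R6: "R6 * E6 = 1"
    unfolding R2_def E2_def R6_def E6_def by (rule qfac_recip_euler_prod, simp)+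
  have W: "W * E3 = E9"
  proof -
    have "inj_on (\<lambda>j. 6*j+3) {..<2*N}" "inj_on (\<lambda>j. 18*j+9) {..<2*N}" by (auto intro!: inj_onI)
    moreover have "(1 + fps_X ^ (6*j+3) + fps_X ^ (12*j+6)) * (1 - fps_X ^ (6*j+3)) = (1 - fps_X ^ (18*j+9) :: 'a fps)" for j
    proof -
      have "(fps_X :: 'a fps) ^ (12*j+6) = (fps_X ^ (6*j+3)) ^ 2" "(fps_X :: 'a fps) ^ (18*j+9) = (fps_X ^ (6*j+3)) ^ 3"
        by (simp_all only: power_mult [symmetric]) (simp_all add: algebra_simps)
      then show ?thesis by (simp only: power2_eq_square power3_eq_cube) (simp only: algebra_simps, simp)
    qed
    ultimately show ?thesis
      unfolding W_def E3_def E9_def euler_prod_def by (simp only: prod.reindex o_def prod.distrib [symmetric])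
  qed
  have "fps_eq_upto N (G * R6) (W * R2)"
  proof -
    define \<Theta> :: "'a fps" where "\<Theta> = (\<Sum>r=-int (2*N)..int (2*N). period6 r * (fps_X ^ 3) ^ nat (r\<^sup>2))"
    have "fps_eq_upto N (G * R6) ((\<Theta> * R2) * R6)"
      unfolding G_def R2_def \<Theta>_def by (intro fps_eq_upto_mult signed_series_theta fps_eq_upto_refl)
    moreover have "fps_eq_upto N (W * R2) ((\<Theta> * R6) * R2)"
      unfolding W_def R6_def \<Theta>_def by (intro fps_eq_upto_mult product_theta fps_eq_upto_refl)
    ultimately show ?thesis by (metis fps_eq_upto_sym fps_eq_upto_trans mult.assoc mult.commute)
  qed
  then have "fps_eq_upto N (G * R6 * (E2 * E6 * E3)) (W * R2 * (E2 * E6 * E3))"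
    by (rule fps_eq_upto_mult[OF _ fps_eq_upto_refl])
  moreover have "G * R6 * (E2 * E6 * E3) = G * (E2 * E3) * (R6 * E6)"
    "W * R2 * (E2 * E6 * E3) = (W * E3) * E6 * (R2 * E2)" by (simp_all only: mult_ac)
  ultimately have 1: "fps_eq_upto N (G * (E2 * E3)) (E9 * E6)"
    by (simp only: R2 R6 W mult_1_right)

  have E: "fps_eq_upto N E2 (P {0,2,4,6,8,10,12,14,16})" "fps_eq_upto N E6 (P {0,6,12})"
    "fps_eq_upto N E3 (P {3,9,15})" "fps_eq_upto N E9 (P {9})"
  proof -
    have "(s mod 18 \<in> {0,2,4,6,8,10,12,14,16}) = (s mod 2 = 0)" "(s mod 18 \<in> {0,6,12}) = (s mod 6 = 0)"
      "(s mod 18 \<in> {3,9,15}) = (s mod 6 = 3)" "(s mod 18 \<in> {9}) = (s mod 18 = 9)" for s :: nat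
    proof -
      have "\<forall>k\<in>set [0..<18 :: nat]. (k \<in> {0,2,4,6,8,10,12,14,16}) = (k mod 2 = 0) \<and>
        (k \<in> {0,6,12}) = (k mod 6 = 0) \<and> (k \<in> {3,9,15}) = (k mod 6 = 3)"
        by code_simp
      moreover have "s mod 18 \<in> set [0..<18]" "s mod 18 mod 2 = s mod 2" "s mod 18 mod 6 = s mod 6"
        by (simp_all add: mod_mod_cancel)
      ultimately show "(s mod 18 \<in> {0,2,4,6,8,10,12,14,16}) = (s mod 2 = 0)"
        "(s mod 18 \<in> {0,6,12}) = (s mod 6 = 0)" "(s mod 18 \<in> {3,9,15}) = (s mod 6 = 3)"
        by metis+
    qed simp
    then have P: "P {0,2,4,6,8,10,12,14,16} = euler_prod {s\<in>{1..N}. s mod 2 = 0}"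
      "P {0,6,12} = euler_prod {s\<in>{1..N}. s mod 6 = 0}"
      "P {3,9,15} = euler_prod {s\<in>{1..N}. s mod 6 = 3}"
      "P {9} = euler_prod {s\<in>{1..N}. s mod 18 = 9}"
      unfolding P_def by (simp_all only:)
    show "fps_eq_upto N E2 (P {0,2,4,6,8,10,12,14,16})" "fps_eq_upto N E6 (P {0,6,12})"
      unfolding P E2_def E6_def by (rule euler_prod_truncate[OF _ _ multiples_upto]; simp)+
    show "fps_eq_upto N E3 (P {3,9,15})" "fps_eq_upto N E9 (P {9})"
      unfolding P E3_def E9_def by (rule euler_prod_truncate[OF _ _ progression_upto]; simp)+
  qed
  have spl: "P (A \<union> B) = P A * P B" if "A \<inter> B = {}" for A B
  proof -
    have "{s\<in>{1..N}. s mod 18 \<in> A \<union> B} = {s\<in>{1..N}. s mod 18 \<in> A} \<union> {s\<in>{1..N}. s mod 18 \<in> B}" by blast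
    then show ?thesis unfolding P_def euler_prod_def using that by (simp only:) (rule prod.union_disjoint, auto)
  qed
  have P2: "P {0,2,4,6,8,10,12,14,16} = P {0,6,12} * P {2,4,8,10,14,16}"
    by (subst spl [symmetric]) (auto intro!: arg_cong[of _ _ P])
  have P3: "P {3,9,15} = P {9} * P {3,15}"
    by (subst spl [symmetric]) (auto intro!: arg_cong[of _ _ P])
  have PT: "P {2,3,4,8,10,14,15,16} = P {2,4,8,10,14,16} * P {3,15}"
    by (subst spl [symmetric]) (auto intro!: arg_cong[of _ _ P])
  have "fps_eq_upto N (G * (P {0,2,4,6,8,10,12,14,16} * P {3,9,15})) (P {9} * P {0,6,12})"
  proof -
    have "fps_eq_upto N (G * (P {0,2,4,6,8,10,12,14,16} * P {3,9,15})) (G * (E2 * E3))"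
      using E by (intro fps_eq_upto_mult fps_eq_upto_refl) (auto intro: fps_eq_upto_sym)
    also note 1
    also have "fps_eq_upto N (E9 * E6) (P {9} * P {0,6,12})"
      using E by (intro fps_eq_upto_mult)
    finally show ?thesis .
  qed
  then have "fps_eq_upto N ((P {0,6,12} * P {9}) * (G * P {2,3,4,8,10,14,15,16})) ((P {0,6,12} * P {9}) * 1)"
    by (simp only: P2 P3 PT mult_ac mult_1_left)
  moreover have "(P {0,6,12} * P {9}) $ 0 \<noteq> 0"
    unfolding P_def by (simp add: euler_prod_nth_0)
  ultimately show ?thesis unfolding G_def P_def by (rule fps_eq_upto_cancel)
qed

section \<open>Generating functions of weighted sets\<close>

text \<open>
  Fibres are counted by \<open>card\<close>, which is \<open>0\<close> for infinite sets; hence the finiteness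
  assumptions in the sum and product rules.
\<close>

definition weight_gf :: "'b set \<Rightarrow> ('b \<Rightarrow> nat) \<Rightarrow> rat fps" where
  "weight_gf A w = Abs_fps (\<lambda>n. of_nat (card {x\<in>A. w x = n}))"

lemma weight_gf_nth: "weight_gf A w $ n = of_nat (card {x\<in>A. w x = n})"
  by (simp add: weight_gf_def)

lemma weight_gf_Un:
  assumes "A \<inter> B = {}" "\<And>n. finite {x\<in>A. w x = n}" "\<And>n. finite {x\<in>B. w x = n}"
  shows "weight_gf (A \<union> B) w = weight_gf A w + weight_gf B w"
proof (rule fps_ext)
  fix n
  have "{x\<in>A \<union> B. w x = n} = {x\<in>A. w x = n} \<union> {x\<in>B. w x = n}" by blast
  moreover have "card \<dots> = card {x\<in>A. w x = n} + card {x\<in>B. w x = n}"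
    using assms by (intro card_Un_disjoint) auto
  ultimately show "weight_gf (A \<union> B) w $ n = (weight_gf A w + weight_gf B w) $ n"
    by (simp add: weight_gf_nth)
qed

lemma weight_gf_UN:
  assumes "finite I" "\<And>i j. i \<in> I \<Longrightarrow> j \<in> I \<Longrightarrow> i \<noteq> j \<Longrightarrow> A i \<inter> A j = {}"
    and "\<And>i n. i \<in> I \<Longrightarrow> finite {x\<in>A i. w x = n}"
  shows "weight_gf (\<Union>i\<in>I. A i) w = (\<Sum>i\<in>I. weight_gf (A i) w)"
proof (rule fps_ext)
  fix n
  have "{x\<in>\<Union>i\<in>I. A i. w x = n} = (\<Union>i\<in>I. {x\<in>A i. w x = n})" by blast
  moreover have "card \<dots> = (\<Sum>i\<in>I. card {x\<in>A i. w x = n})"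
    using assms(1,3) assms(2) by (intro card_UN_disjoint) blast+
  ultimately show "weight_gf (\<Union>i\<in>I. A i) w $ n = (\<Sum>i\<in>I. weight_gf (A i) w) $ n"
    by (simp only: weight_gf_nth fps_sum_nth of_nat_sum)
qed

lemma weight_gf_image:
  assumes "inj_on f B" "\<And>x. x \<in> B \<Longrightarrow> w (f x) = v x + d"
  shows "weight_gf (f ` B) w = fps_X ^ d * weight_gf B v"
proof (rule fps_ext)
  fix n
  show "weight_gf (f ` B) w $ n = (fps_X ^ d * weight_gf B v) $ n"
  proof (cases "n < d")
    case True
    then have "{x\<in>f ` B. w x = n} = {}" using assms(2) by auto
    then show ?thesis using True by (simp only: weight_gf_nth fps_X_power_mult_nth) simp
  next
    case False
    then have "{x\<in>f ` B. w x = n} = f ` {x\<in>B. v x = n - d}" using assms(2) by auto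
    moreover have "card (f ` {x\<in>B. v x = n - d}) = card {x\<in>B. v x = n - d}"
      by (rule card_image) (rule inj_on_subset[OF assms(1)], auto)
    ultimately show ?thesis using False by (simp add: weight_gf_nth fps_X_power_mult_nth)
  qed
qed

lemma weight_gf_Times:
  assumes fA: "\<And>n. finite {x\<in>A. w x = n}" and fB: "\<And>n. finite {x\<in>B. v x = n}"
  shows "weight_gf (A \<times> B) (\<lambda>(a, b). w a + v b) = weight_gf A w * weight_gf B v"
proof (rule fps_ext)
  fix n
  have "{x\<in>A \<times> B. (\<lambda>(a, b). w a + v b) x = n} = (\<Union>i\<in>{0..n}. {x\<in>A. w x = i} \<times> {x\<in>B. v x = n - i})"
    by auto
  moreover have "card \<dots> = (\<Sum>i=0..n. card ({x\<in>A. w x = i} \<times> {x\<in>B. v x = n - i}))"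
    using fA fB by (intro card_UN_disjoint) auto
  ultimately show "weight_gf (A \<times> B) (\<lambda>(a, b). w a + v b) $ n = (weight_gf A w * weight_gf B v) $ n"
    by (simp only: weight_gf_nth fps_mult_nth) (simp add: card_cartesian_product)
qed

lemma finite_weight_Times:
  assumes fA: "\<And>n. finite {x\<in>A. w x = n}" and fB: "\<And>n. finite {x\<in>B. v x = n}"
  shows "finite {x\<in>A \<times> B. (\<lambda>(a, b). w a + v b :: nat) x = n}"
proof -
  have "{x\<in>A \<times> B. (\<lambda>(a, b). w a + v b) x = n} = (\<Union>i\<in>{0..n}. {x\<in>A. w x = i} \<times> {x\<in>B. v x = n - i})"
    by auto
  then show ?thesis using fA fB by simp
qed

section \<open>Multisets of natural numbers\<close>

lemma finite_multisets_size_le: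
  assumes "finite A"
  shows "finite {M. set_mset M \<subseteq> A \<and> size M \<le> k}"
proof (rule finite_subset)
  show "{M. set_mset M \<subseteq> A \<and> size M \<le> k} \<subseteq> mset ` {xs. set xs \<subseteq> A \<and> length xs \<le> k}"
  proof
    fix M assume M: "M \<in> {M. set_mset M \<subseteq> A \<and> size M \<le> k}"
    obtain xs where "M = mset xs" by (metis ex_mset)
    then show "M \<in> mset ` {xs. set xs \<subseteq> A \<and> length xs \<le> k}" using M by auto
  qed
qed (use finite_lists_length_le[OF assms] in simp)

lemma member_le_sum_mset: "x \<in># M \<Longrightarrow> x \<le> \<Sum>\<^sub># (M :: nat multiset)"
  by (auto dest!: multi_member_split)

lemma size_le_sum_mset: "0 \<notin># M \<Longrightarrow> size M \<le> \<Sum>\<^sub># (M :: nat multiset)"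
  by (induction M) auto

lemma finite_pos_multisets_sum: "finite {M. 0 \<notin># M \<and> \<Sum>\<^sub># (M :: nat multiset) = n}"
proof (rule finite_subset[OF _ finite_multisets_size_le[of "{..n}" n]])
  show "{M. 0 \<notin># M \<and> \<Sum>\<^sub># M = n} \<subseteq> {M. set_mset M \<subseteq> {..n} \<and> size M \<le> n}"
    using member_le_sum_mset size_le_sum_mset by auto
qed simp

lemma finite_size_sum_multisets: "finite {M. size M = k \<and> \<Sum>\<^sub># (M :: nat multiset) = n}"
proof (rule finite_subset[OF _ finite_multisets_size_le[of "{..n}" k]])
  show "{M. size M = k \<and> \<Sum>\<^sub># M = n} \<subseteq> {M. set_mset M \<subseteq> {..n} \<and> size M \<le> k}"
    using member_le_sum_mset by auto
qed simp

text \<open>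
  A multiset over \<open>insert s A\<close> either avoids \<open>s\<close> or arises from another one by adding
  a copy of \<open>s\<close>.
\<close>

lemma partitions_gf:
  assumes "finite A" "0 \<notin> A"
  shows "weight_gf {M. set_mset M \<subseteq> A} sum_mset * euler_prod A = 1"
  using assms
proof (induction A rule: finite_induct)
  case empty
  have "weight_gf {M. set_mset M \<subseteq> {}} sum_mset $ n = (1 :: rat fps) $ n" for n
  proof -
    have "{M \<in> {M. set_mset M \<subseteq> {}}. \<Sum>\<^sub># M = n} = (if n = 0 then {{#}} else {} :: nat multiset set)" by auto
    then show ?thesis by (simp add: weight_gf_nth)
  qed
  then show ?case by (simp add: euler_prod_def fps_eq_iff)
next
  case (insert s A)
  define P where "P = (\<lambda>A. {M :: nat multiset. set_mset M \<subseteq> A})"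
  have fin: "finite {M\<in>C. \<Sum>\<^sub># M = n}" if "\<And>M. M \<in> C \<Longrightarrow> 0 \<notin># M" for C and n :: nat
    by (rule finite_subset[OF _ finite_pos_multisets_sum[of n]]) (use that in auto)
  have "P (insert s A) = P A \<union> add_mset s ` P (insert s A)"
  proof (intro subset_antisym subsetI)
    fix M assume M: "M \<in> P (insert s A)"
    show "M \<in> P A \<union> add_mset s ` P (insert s A)"
    proof (cases "s \<in># M")
      case True
      then obtain M' where "M = add_mset s M'" by (metis multi_member_split)
      then show ?thesis using M by (auto simp: P_def)
    qed (use M in \<open>auto simp: P_def\<close>)
  qed (auto simp: P_def)
  moreover have "weight_gf (P A \<union> add_mset s ` P (insert s A)) sum_mset
      = weight_gf (P A) sum_mset + weight_gf (add_mset s ` P (insert s A)) sum_mset"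
    using insert by (intro weight_gf_Un fin) (auto simp: P_def)
  moreover have "weight_gf (add_mset s ` P (insert s A)) sum_mset = fps_X ^ s * weight_gf (P (insert s A)) sum_mset"
    by (rule weight_gf_image) (auto intro: inj_onI)
  ultimately have "weight_gf (P (insert s A)) sum_mset * (1 - fps_X ^ s) = weight_gf (P A) sum_mset"
    by (simp add: algebra_simps)
  moreover have "euler_prod (insert s A) = (1 - fps_X ^ s) * (euler_prod A :: rat fps)"
    using insert by (simp add: euler_prod_def)
  ultimately show ?case using insert by (simp add: P_def mult.assoc [symmetric])
qed

text \<open>
  A multiset of size \<open>k + 1\<close> either contains \<open>0\<close>, and deleting one \<open>0\<close> leaves size \<open>k\<close>
  and the same sum, or all its elements can be lowered by \<open>1\<close>. With \<open>G\<close> for the series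
  this reads \<open>G\<^bsub>k+1\<^esub> = G\<^sub>k + X\<^bsup>c(k+1)\<^esup> G\<^bsub>k+1\<^esub>\<close>.
\<close>

lemma fixed_size_gf:
  assumes "0 < c"
  shows "weight_gf {M. size M = k} (\<lambda>M. c * \<Sum>\<^sub># M) = qfac_recip (fps_X ^ c) (int k)"
proof (induction k)
  case 0
  have "weight_gf {M. size M = 0} (\<lambda>M. c * \<Sum>\<^sub># M) $ n = (1 :: rat fps) $ n" for n
  proof -
    have "{M \<in> {M. size M = 0}. c * \<Sum>\<^sub># M = n} = (if n = 0 then {{#}} else {} :: nat multiset set)" by auto
    then show ?thesis by (simp add: weight_gf_nth)
  qed
  then show ?case by (simp add: fps_eq_iff)
next
  case (Suc k)
  define H where "H = (\<lambda>k. {M :: nat multiset. size M = k})"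
  define w where "w = (\<lambda>M :: nat multiset. c * \<Sum>\<^sub># M)"
  have fin: "finite {M\<in>C. w M = n}" if "C \<subseteq> H k" for C n k
  proof (rule finite_subset[OF _ finite_size_sum_multisets[of k "n div c"]])
    show "{M\<in>C. w M = n} \<subseteq> {M. size M = k \<and> \<Sum>\<^sub># M = n div c}"
      using that assms by (auto simp: H_def w_def)
  qed
  have split: "H (Suc k) = add_mset 0 ` H k \<union> image_mset Suc ` H (Suc k)"
  proof (intro subset_antisym subsetI)
    fix M assume M: "M \<in> H (Suc k)"
    show "M \<in> add_mset 0 ` H k \<union> image_mset Suc ` H (Suc k)"
    proof (cases "0 \<in># M")
      case True
      then obtain M' where "M = add_mset 0 M'" by (metis multi_member_split)
      then show ?thesis using M by (auto simp: H_def)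
    next
      case False
      then have "image_mset Suc (image_mset (\<lambda>x. x - 1) M) = image_mset id M"
        unfolding image_mset.compositionality by (intro image_mset_cong) (auto simp: gr0_conv_Suc intro!: Suc_pred gr0I)
      then have "M = image_mset Suc (image_mset (\<lambda>x. x - 1) M)" by simp
      then show ?thesis using M by (auto simp: H_def)
    qed
  qed (auto simp: H_def)
  have "weight_gf (H (Suc k)) w = weight_gf (add_mset 0 ` H k) w + weight_gf (image_mset Suc ` H (Suc k)) w"
  proof (subst (1) split, rule weight_gf_Un[OF _ fin[of _ "Suc k"] fin[of _ "Suc k"]])
    have "0 \<in># M" if "M \<in> add_mset 0 ` H k" for M using that by auto
    moreover have "0 \<notin># M" if "M \<in> image_mset Suc ` H (Suc k)" for M using that by auto
    ultimately show "add_mset 0 ` H k \<inter> image_mset Suc ` H (Suc k) = {}" by blast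
  qed (auto simp: H_def)
  also have "weight_gf (add_mset 0 ` H k) w = weight_gf (H k) w"
    using weight_gf_image[of "add_mset 0" "H k" w w 0] by (simp add: w_def inj_on_def)
  also have "weight_gf (image_mset Suc ` H (Suc k)) w = fps_X ^ (c * Suc k) * weight_gf (H (Suc k)) w"
  proof (rule weight_gf_image)
    show "inj_on (image_mset Suc) (H (Suc k))"
      by (rule inj_on_inverseI[of _ "image_mset (\<lambda>x. x - 1)"]) (simp add: image_mset.compositionality o_def)
    fix M assume "M \<in> H (Suc k)"
    moreover have "\<Sum>\<^sub># (image_mset Suc M) = \<Sum>\<^sub># M + size M" for M by (induction M) auto
    ultimately show "w (image_mset Suc M) = w M + c * Suc k"
      by (simp add: w_def H_def distrib_left)
  qed
  finally have "(1 - (fps_X ^ c) ^ Suc k) * weight_gf (H (Suc k)) w = weight_gf (H k) w"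
    unfolding power_mult [symmetric] left_diff_distrib mult_1_left diff_eq_eq .
  also have "\<dots> = (1 - (fps_X ^ c) ^ Suc k) * qfac_recip (fps_X ^ c) (int (Suc k))"
    using Suc qfac_recip_Suc[of "fps_X ^ c :: rat fps" k] assms
    by (simp only: H_def w_def) (simp add: fps_power_zeroth)
  finally show ?case
    using one_minus_power_neq_0[of "fps_X ^ c :: rat fps" "Suc k"] assms
    by (simp add: H_def w_def fps_power_zeroth del: power_Suc of_nat_Suc)
qed

definition odd_twice :: "nat \<Rightarrow> nat multiset set" where
  "odd_twice m = {M. \<forall>q\<in>#M. odd q \<and> q < 2 * m \<and> count M q \<le> 2}"

lemma odd_twice_0: "odd_twice 0 = {{#}}"
  by (auto simp: odd_twice_def)

lemma odd_twice_Suc: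
  "odd_twice (Suc m) = (\<Union>c\<le>2. (\<lambda>M. M + replicate_mset c (2*m+1)) ` odd_twice m)" (is "_ = ?U")
proof (intro subset_antisym subsetI)
  fix M assume M: "M \<in> odd_twice (Suc m)"
  define M' where "M' = filter_mset (\<lambda>q. q \<noteq> 2*m+1) M"
  have eq: "M = M' + replicate_mset (count M (2*m+1)) (2*m+1)"
    by (rule multiset_eqI) (auto simp: M'_def)
  have "count M (2*m+1) \<le> 2" using M by (cases "2*m+1 \<in># M") (auto simp: odd_twice_def not_in_iff)
  moreover have "M' \<in> odd_twice m"
  proof -
    have "q < 2 * m" if "q \<noteq> 2*m+1" "odd q" "q < 2 * Suc m" for q using that by (auto elim!: oddE)
    then show ?thesis using M unfolding odd_twice_def M'_def by auto
  qed
  ultimately show "M \<in> ?U" using eq by blast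
next
  fix M assume "M \<in> ?U"
  then obtain M' c where M': "M' \<in> odd_twice m" "c \<le> 2" "M = M' + replicate_mset c (2*m+1)"
    by auto
  have "q < 2*m" if "q \<in># M'" for q using that M'(1) unfolding odd_twice_def by blast
  from this[of "2*m+1"] have nin: "2*m+1 \<notin># M'" by linarith
  then have 0: "count M' (2*m+1) = 0" by (rule not_in_iff[THEN iffD1])
  show "M \<in> odd_twice (Suc m)" unfolding odd_twice_def mem_Collect_eq
  proof
    fix q assume "q \<in># M"
    then have "q \<in># M' \<or> q = 2*m+1" unfolding M'(3) by (auto split: if_splits)
    then consider "q \<in># M'" "q \<noteq> 2*m+1" | "q = 2*m+1" using nin by blast
    then show "odd q \<and> q < 2 * Suc m \<and> count M q \<le> 2"
    proof cases
      case 1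
      then have "count M q = count M' q" unfolding M'(3) by simp
      moreover have "odd q \<and> q < 2 * m \<and> count M' q \<le> 2"
        using 1(1) M'(1) unfolding odd_twice_def by blast
      ultimately show ?thesis by simp
    next
      case 2
      then have "count M q = c" unfolding M'(3) using 0 by simp
      then show ?thesis using 2 M'(2) by simp
    qed
  qed
qed

lemma finite_odd_twice: "finite (odd_twice m)"
  by (induction m) (simp_all add: odd_twice_0 odd_twice_Suc)

lemma sum_odd_twice: "M \<in> odd_twice m \<Longrightarrow> \<Sum>\<^sub># M \<le> 2 * m\<^sup>2"
proof (induction m arbitrary: M)
  case 0
  then show ?case by (simp add: odd_twice_0)
next
  case (Suc m)
  then obtain M' c where M': "M' \<in> odd_twice m" "c \<le> 2" "M = M' + replicate_mset c (2*m+1)"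
    unfolding odd_twice_Suc by auto
  have "\<Sum>\<^sub># M = \<Sum>\<^sub># M' + c * (2*m+1)" using M'(3) by simp
  also have "\<dots> \<le> 2 * m\<^sup>2 + 2 * (2*m+1)"
    by (rule add_mono[OF Suc.IH[OF M'(1)] mult_le_mono1[OF M'(2)]])
  finally show ?case by (simp add: power2_eq_square)
qed

text \<open>
  The largest possible sum in \<open>odd_twice m\<close> is \<open>2 (1 + 3 + \<dots> + (2m - 1)) = 2 m\<^sup>2\<close>.
  Counting the deficit from it turns the negative powers of \<open>X\<close> that the negative
  parts would contribute into an ordinary polynomial: using \<open>c\<close> copies of \<open>2m + 1\<close>
  leaves a deficit of \<open>(2 - c) (2m + 1)\<close>.
\<close>

lemma odd_twice_gf:
  "weight_gf (odd_twice m) (\<lambda>M. 2 * m\<^sup>2 - \<Sum>\<^sub># M) = (\<Prod>j<m. 1 + fps_X ^ (2*j+1) + fps_X ^ (4*j+2))"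
proof (induction m)
  case 0
  have "{M. M = {#} \<and> 2 * 0\<^sup>2 - \<Sum>\<^sub># M = n} = (if n = 0 then {{#}} else {} :: nat multiset set)" for n by auto
  then show ?case by (simp add: odd_twice_0 weight_gf_nth fps_eq_iff)
next
  case (Suc m)
  define w where "w = (\<lambda>m M. 2 * m\<^sup>2 - \<Sum>\<^sub># M :: nat)"
  define D where "D = (\<lambda>c. (\<lambda>M. M + replicate_mset c (2*m+1)) ` odd_twice m)"
  have nin: "count M (2*m+1) = 0" if "M \<in> odd_twice m" for M
    using that by (fastforce simp: odd_twice_def not_in_iff [symmetric])
  have disj: "D c \<inter> D d = {}" if "c \<noteq> d" for c d
  proof -
    have "count M (2*m+1) = c" if "M \<in> D c" for M c using that nin by (auto simp: D_def)
    then show ?thesis using that by blast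
  qed
  have fin: "finite {x\<in>D c. w (Suc m) x = n}" for c n by (simp add: D_def finite_odd_twice)
  have D: "weight_gf (D c) (w (Suc m)) = fps_X ^ ((2 - c) * (2*m+1)) * weight_gf (odd_twice m) (w m)"
    if "c \<le> 2" for c
    unfolding D_def
  proof (rule weight_gf_image)
    fix M assume M: "M \<in> odd_twice m"
    have "c * (2*m+1) + (2 - c) * (2*m+1) = 2 * (2*m+1)"
      using that by (simp only: distrib_right [symmetric]) simp
    moreover have "2 * (Suc m)\<^sup>2 = 2 * m\<^sup>2 + 2 * (2*m+1)" by (simp add: power2_eq_square)
    moreover have "\<Sum>\<^sub># (M + replicate_mset c (2*m+1)) = \<Sum>\<^sub># M + c * (2*m+1)" by simp
    ultimately show "w (Suc m) (M + replicate_mset c (2*m+1)) = w m M + (2 - c) * (2*m+1)"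
      unfolding w_def using sum_odd_twice[OF M] by linarith
  qed (auto intro: inj_onI)
  have "weight_gf (odd_twice (Suc m)) (w (Suc m)) = (\<Sum>c\<le>2. weight_gf (D c) (w (Suc m)))"
    unfolding odd_twice_Suc D_def [symmetric] using disj fin by (intro weight_gf_UN) auto
  also have "\<dots> = weight_gf (odd_twice m) (w m) * (1 + fps_X ^ (2*m+1) + fps_X ^ (4*m+2))"
    by (simp add: D atMost_nat_numeral numeral_2_eq_2 algebra_simps)
  finally show ?case using Suc by (simp add: w_def)
qed

lemma finite_weight_image:
  assumes "\<And>x. x \<in> B \<Longrightarrow> w (f x) = v x + d" "\<And>n. finite {x\<in>B. v x = n}"
  shows "finite {y\<in>f ` B. w y = (n :: nat)}"
  by (rule finite_subset[of _ "f ` {x\<in>B. v x = n - d}"]) (use assms in auto)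

section \<open>Signed partitions\<close>

definition signed_pairs :: "nat \<Rightarrow> (nat multiset \<times> nat multiset) set" where
  "signed_pairs m = {P. size P = 2 * m \<and> (\<forall>p\<in>#P. even p \<and> 2 * m \<le> p)} \<times> odd_twice m"

definition signed_weight :: "nat multiset \<times> nat multiset \<Rightarrow> nat" where
  "signed_weight = (\<lambda>(P, V). \<Sum>\<^sub># P - \<Sum>\<^sub># V)"

text \<open>
  The \<open>2m\<close> positive parts add up to at least \<open>4 m\<^sup>2\<close>, twice the maximum for the
  negative ones. Hence the truncated subtraction in \<open>signed_weight\<close> is exact, and a
  signed partition of \<open>n\<close> has \<open>2 m\<^sup>2 \<le> n\<close>.
\<close>

lemma signed_pairs_sum:
  assumes "(P, V) \<in> signed_pairs m"
  shows "\<Sum>\<^sub># P \<ge> \<Sum>\<^sub># V + 2 * m\<^sup>2"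
proof -
  have "size P * k \<le> \<Sum>\<^sub># P" if "\<forall>p\<in>#P. k \<le> p" for k and P :: "nat multiset"
    using that by (induction P) auto
  from this[of P "2 * m"] have "4 * m\<^sup>2 \<le> \<Sum>\<^sub># P"
    using assms by (simp add: signed_pairs_def power2_eq_square)
  moreover have "\<Sum>\<^sub># V \<le> 2 * m\<^sup>2" using assms by (intro sum_odd_twice) (simp add: signed_pairs_def)
  ultimately show ?thesis by linarith
qed

text \<open>
  Write the positive parts as \<open>2m + 2k\<close>: they contribute \<open>4 m\<^sup>2\<close> and twice the sum of
  the numbers \<open>k\<close>, while the negative parts contribute \<open>-2 m\<^sup>2\<close> and their deficit. The
  two choices are independent, whence the product.
\<close>

lemma signed_pairs_gf:
  "weight_gf (signed_pairs m) signed_weight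
     = fps_X ^ (2 * m\<^sup>2) * qfac_recip (fps_X\<^sup>2) (int (2 * m)) * (\<Prod>j<m. 1 + fps_X ^ (2*j+1) + fps_X ^ (4*j+2))"
  and finite_signed_pairs: "finite {x\<in>signed_pairs m. signed_weight x = n}"
proof -
  define H where "H = {M :: nat multiset. size M = 2 * m}"
  define f where "f = map_prod (image_mset (\<lambda>k. 2 * m + 2 * k)) (id :: nat multiset \<Rightarrow> _)"
  define v where "v = (\<lambda>(M, V). 2 * \<Sum>\<^sub># M + (2 * m\<^sup>2 - \<Sum>\<^sub># V) :: nat)"
  have img: "{P. size P = 2 * m \<and> (\<forall>p\<in>#P. even p \<and> 2 * m \<le> p)} = image_mset (\<lambda>k. 2 * m + 2 * k) ` H" (is "?L = _")
  proof (intro subset_antisym subsetI)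
    fix P assume P: "P \<in> ?L"
    have "image_mset (\<lambda>k. 2 * m + 2 * k) (image_mset (\<lambda>p. (p - 2 * m) div 2) P) = image_mset id P"
      unfolding image_mset.compositionality using P by (intro image_mset_cong) auto
    then have "P = image_mset (\<lambda>k. 2 * m + 2 * k) (image_mset (\<lambda>p. (p - 2 * m) div 2) P)" by simp
    then show "P \<in> image_mset (\<lambda>k. 2 * m + 2 * k) ` H" using P by (rule_tac image_eqI) (auto simp: H_def)
  qed (auto simp: H_def)
  then have sp: "signed_pairs m = f ` (H \<times> odd_twice m)"
    unfolding signed_pairs_def f_def by (simp only: map_prod_surj_on[OF refl refl] image_id id_apply)
  have w: "signed_weight (f x) = v x + 2 * m\<^sup>2" if xin: "x \<in> H \<times> odd_twice m" for x
  proof -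
    obtain M V where x: "x = (M, V)" "size M = 2 * m" "V \<in> odd_twice m"
      by (rule SigmaE[OF xin]) (simp add: H_def)
    have "\<Sum>\<^sub># (image_mset (\<lambda>k. 2 * m + 2 * k) M) = size M * (2 * m) + 2 * \<Sum>\<^sub># M" for M
      by (induction M) auto
    then have "\<Sum>\<^sub># (image_mset (\<lambda>k. 2 * m + 2 * k) M) = 4 * m\<^sup>2 + 2 * \<Sum>\<^sub># M"
      using x(2) by (simp add: power2_eq_square)
    then show ?thesis using sum_odd_twice[OF x(3)] by (simp add: x(1) f_def v_def signed_weight_def)
  qed
  have finH: "finite {M\<in>H. 2 * \<Sum>\<^sub># M = n}" for n
    by (rule finite_subset[OF _ finite_size_sum_multisets[of "2 * m" "n div 2"]]) (auto simp: H_def)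
  have finD: "finite {V\<in>odd_twice m. 2 * m\<^sup>2 - \<Sum>\<^sub># V = n}" for n
    by (simp add: finite_odd_twice)
  show "finite {x\<in>signed_pairs m. signed_weight x = n}"
    unfolding sp using w finite_weight_Times[OF finH finD] by (intro finite_weight_image) (auto simp: v_def)
  have "inj_on (image_mset (\<lambda>k. 2 * m + 2 * k)) H"
    by (rule inj_on_inverseI[of _ "image_mset (\<lambda>p. (p - 2 * m) div 2)"])
       (simp add: image_mset.compositionality o_def)
  then have "inj_on f (H \<times> odd_twice m)"
    unfolding f_def by (intro map_prod_inj_on) auto
  then have "weight_gf (signed_pairs m) signed_weight = fps_X ^ (2 * m\<^sup>2) * weight_gf (H \<times> odd_twice m) v"
    unfolding sp using w by (rule weight_gf_image)
  also have "weight_gf (H \<times> odd_twice m) v = qfac_recip (fps_X\<^sup>2) (int (2 * m)) * (\<Prod>j<m. 1 + fps_X ^ (2*j+1) + fps_X ^ (4*j+2))"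
    unfolding v_def weight_gf_Times[OF finH finD] odd_twice_gf
    unfolding H_def by (subst fixed_size_gf) simp_all
  finally show "weight_gf (signed_pairs m) signed_weight
     = fps_X ^ (2 * m\<^sup>2) * qfac_recip (fps_X\<^sup>2) (int (2 * m)) * (\<Prod>j<m. 1 + fps_X ^ (2*j+1) + fps_X ^ (4*j+2))"
    by (simp only: mult.assoc)
qed

lemma signed_series_gf: "weight_gf (\<Union>m\<le>N. signed_pairs m) signed_weight = signed_series N"
  unfolding signed_series_def signed_pairs_gf [symmetric]
  by (rule weight_gf_UN) (auto simp: signed_pairs_def finite_signed_pairs[unfolded signed_pairs_def])

text \<open>
  Decreasing lists of positive numbers stand for multisets without \<open>0\<close>, where the
  generating functions are available.
\<close>

lemma bij_betw_mset_partition: "bij_betw mset {xs. is_partition xs} {M. 0 \<notin># M}"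
proof (rule bij_betw_byWitness[where f' = "\<lambda>M. rev (sorted_list_of_multiset M)"])
  show "\<forall>xs\<in>{xs. is_partition xs}. rev (sorted_list_of_multiset (mset xs)) = xs"
  proof
    fix xs :: "nat list" assume "xs \<in> {xs. is_partition xs}"
    then have "sorted (rev xs)" by (simp add: is_partition_def sorted_wrt_rev)
    then have "sort xs = rev xs" by (intro properties_for_sort) simp_all
    then show "rev (sorted_list_of_multiset (mset xs)) = xs" by simp
  qed
  have "is_partition (rev (sorted_list_of_multiset M))" if "0 \<notin># M" for M
    using that by (auto simp: is_partition_def sorted_wrt_rev intro!: gr0I)
  then show "(\<lambda>M. rev (sorted_list_of_multiset M)) ` {M. 0 \<notin># M} \<subseteq> {xs. is_partition xs}" by auto
qed (auto simp: is_partition_def)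

theorem theorem4p9:
  fixes n :: nat
  defines "S \<equiv> {(\<pi>, \<nu>). signed_partition_of (\<pi>, \<nu>) (int n) \<and>
       even (length \<pi>) \<and> (\<forall>p\<in>set \<pi>. even p \<and> length \<pi> \<le> p) \<and>
       (\<forall>q\<in>set \<nu>. odd q \<and> q < length \<pi> \<and> count_list \<nu> q \<le> 2)}"
    and "T \<equiv> {xs. partition_of xs n \<and>
       (\<forall>p\<in>set xs. \<exists>r\<in>{2, 3, 4, 8}. [int p = r] (mod 18) \<or> [int p = - r] (mod 18))}"
  shows "finite S \<and> card S = card T"
proof -
  define A where "A = {s\<in>{1..n}. s mod 18 \<in> {2,3,4,8,10,14,15,16}}"
  define SM where "SM = {x\<in>\<Union>m\<le>n. signed_pairs m. signed_weight x = n}"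
  define TM where "TM = {M\<in>{M. set_mset M \<subseteq> A}. \<Sum>\<^sub># M = n}"
  have bij_subset: "bij_betw f X' Y'"
    if "bij_betw f X Y" "X' \<subseteq> X" "\<And>x. x \<in> X \<Longrightarrow> x \<in> X' \<longleftrightarrow> f x \<in> Y'" "Y' \<subseteq> Y"
    for f :: "'x \<Rightarrow> 'y" and X X' Y Y'
    using that unfolding bij_betw_def inj_on_def by blast
  have "bij_betw (map_prod mset mset) ({xs. is_partition xs} \<times> {xs. is_partition xs}) ({M. 0 \<notin># M} \<times> {M. 0 \<notin># M})"
    by (intro bij_betw_map_prod bij_betw_mset_partition)
  then have S: "bij_betw (map_prod mset mset) S SM"
  proof (rule bij_subset)
    show "S \<subseteq> {xs. is_partition xs} \<times> {xs. is_partition xs}"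
      by (auto simp: S_def signed_partition_of_def)
    have "0 \<notin># P \<and> 0 \<notin># V" if "(P, V) \<in> signed_pairs m" for P V m
      using that by (auto simp: signed_pairs_def odd_twice_def)
    then show "SM \<subseteq> {M. 0 \<notin># M} \<times> {M. 0 \<notin># M}" by (auto simp: SM_def)
    fix x :: "nat list \<times> nat list" assume x: "x \<in> {xs. is_partition xs} \<times> {xs. is_partition xs}"
    obtain p v where pv: "x = (p, v)" by force
    have count: "count (mset v) q = count_list v q" for q
      by (simp add: count_list_eq_length_filter count_mset)
    show "x \<in> S \<longleftrightarrow> map_prod mset mset x \<in> SM"
    proof
      assume "x \<in> S"
      then obtain m where m: "length p = 2 * m" and mem: "(mset p, mset v) \<in> signed_pairs m"
        and w: "int n = int (sum_list p) - int (sum_list v)"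
        by (auto simp: S_def pv signed_partition_of_def signed_pairs_def odd_twice_def count elim!: evenE)
      have "n = \<Sum>\<^sub># (mset p) - \<Sum>\<^sub># (mset v)" using w by (simp add: sum_mset_sum_list)
      moreover from this have "m * 1 \<le> n"
      proof -
        have "m * 1 \<le> m\<^sup>2" by (simp add: power2_eq_square)
        then show ?thesis using signed_pairs_sum[OF mem] \<open>n = _\<close> by linarith
      qed
      ultimately show "map_prod mset mset x \<in> SM"
        using mem by (auto simp: SM_def pv signed_weight_def)
    next
      assume "map_prod mset mset x \<in> SM"
      then obtain m where mem: "(mset p, mset v) \<in> signed_pairs m" and w: "\<Sum>\<^sub># (mset p) - \<Sum>\<^sub># (mset v) = n"
        by (auto simp: SM_def pv signed_weight_def)
      have "int n = int (sum_list p) - int (sum_list v)"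
        using w signed_pairs_sum[OF mem] by (simp add: sum_mset_sum_list)
      then show "x \<in> S" using mem x
        by (auto simp: S_def pv signed_partition_of_def signed_pairs_def odd_twice_def count)
    qed
  qed
  have T: "bij_betw mset T TM"
  proof (rule bij_subset[OF bij_betw_mset_partition])
    show "T \<subseteq> {xs. is_partition xs}" by (auto simp: T_def partition_of_def)
    show "TM \<subseteq> {M. 0 \<notin># M}" by (auto simp: TM_def A_def)
    fix xs assume xs: "xs \<in> {xs. is_partition xs}"
    have res: "(\<exists>r\<in>{2, 3, 4, 8}. [int p = r] (mod 18) \<or> [int p = - r] (mod 18)) \<longleftrightarrow> p mod 18 \<in> {2,3,4,8,10,14,15,16}" for p
    proof -
      have "int p mod 18 = int k \<longleftrightarrow> p mod 18 = k" for k
        by (metis of_nat_eq_iff of_nat_mod of_nat_numeral)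
      from this[of 2] this[of 3] this[of 4] this[of 8] this[of 10] this[of 14] this[of 15] this[of 16]
      show ?thesis by (simp add: cong_def) blast
    qed
    have "p \<in> {1..n}" if "p \<in> set xs" "sum_list xs = n" for p
      using that xs member_le_sum_list[of p xs] by (auto simp: is_partition_def Suc_le_eq)
    then show "xs \<in> T \<longleftrightarrow> mset xs \<in> TM"
      using xs unfolding T_def TM_def A_def partition_of_def res by (auto simp: sum_mset_sum_list)
  qed
  have "finite SM"
  proof -
    have "SM = (\<Union>m\<le>n. {x\<in>signed_pairs m. signed_weight x = n})" by (auto simp: SM_def)
    then show ?thesis by (simp add: finite_signed_pairs)
  qed
  moreover have "card SM = card TM"
  proof -
    have A: "finite A" "0 \<notin> A" by (auto simp: A_def)
    have "fps_eq_upto n (euler_prod A * signed_series n) (euler_prod A * weight_gf {M. set_mset M \<subseteq> A} sum_mset)"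
      using signed_series_product[of n, where 'a=rat] partitions_gf[OF A]
      by (simp only: mult.commute A_def)
    then have "fps_eq_upto n (signed_series n) (weight_gf {M. set_mset M \<subseteq> A} sum_mset)"
      by (rule fps_eq_upto_cancel) (simp add: euler_prod_nth_0[OF A])
    then have "signed_series n $ n = weight_gf {M. set_mset M \<subseteq> A} sum_mset $ n"
      by (simp add: fps_eq_upto_def)
    then show ?thesis
      unfolding signed_series_gf [symmetric] weight_gf_nth SM_def TM_def by simp
  qed
  ultimately show ?thesis
    using bij_betw_finite[OF S] bij_betw_same_card[OF S] bij_betw_same_card[OF T] by simp
qed

end
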